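(* Let $\psi\in L^2(\mathbb R)$ be an admissible wavelet with constant $C_\psi\neq0$. Let $f\in L^2\left(\mathbb R\times\mathbb R^+,\frac{db\,da}{a^2}\right)$. Then $f$ is the special affine wavelet transform of a certain square integrable function (i.e. $f=\mathcal W_{\mathbf M}^{\psi}[g]$ for some $g\in L^2(\mathbb R)$) if and only if $$f(b',a')=\frac1{C_\psi}\int_{\mathbb R}\int_{\mathbb R^+}f(b,a)\,\left\langle\psi^{\mathbf M}_{b,a},\psi^{\mathbf M}_{b',a'}\right\rangle_{L^2(\mathbb R)}\frac{da\,db}{a^2}$$ for almost every $(b',a')\in\mathbb R\times\mathbb R^+$.
   Context: Fix real numbers $A,B,C,D,p,q$ with $AD-BC=1$ and $B\neq0$, and write $\mathbf M=(A,B,C,D:p,q)$; $\mathbb R^+=(0,\infty)$. Inner products are linear in the first argument. The special affine Fourier transform (SAFT) is $\mathrm S_{\mathbf M}[f](\omega)=\int_{\mathbb R}f(t)\,\mathcal K_{\mathbf M}(t,\omega)\,dt$ with $$\mathcal K_{\mathbf M}(t,\omega)=\frac{1}{\sqrt{i2\pi B}}\exp\left\{\frac{i}{2B}\left(At^2+2t(p-\omega)-2\omega(Dp-Bq)+D(\omega^2+p^2)\right)\right\},$$ extended to $L^2(\mathbb R)$ in the usual $L^2$ (Plancherel) sense. For $\psi\in L^2(\mathbb R)$, $b\in\mathbb R$, $a\in\mathbb R^+$ put $$\psi^{\mathbf M}_{b,a}(t)=\frac{1}{\sqrt{i2\pi aB}}\,\psi\left(\frac{t-b}{a}\right)\exp\left\{-\frac{i}{2B}\left(At^2+Dp^2-A\left(\frac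 ba\right)^2\right)\right\},$$ and define the special affine wavelet transform $\mathcal W_{\mathbf M}^{\psi}[g](b,a)=\int_{\mathbb R}g(t)\,\overline{\psi^{\mathbf M}_{b,a}(t)}\,dt$. Square roots are principal branches. The wavelet $\psi$ is admissible if $$C_\psi=\int_{\mathbb R^+}\frac{1}{a}\left|\mathrm S_{\mathbf M}\left[\exp\left\{\frac{i}{2B}\left(2zp(a-1)-Az^2\right)\right\}\overline{\psi(-z)}\right](a\omega)\right|^2da<\infty\quad\text{for a.e. }\omega\in\mathbb R,$$ where the SAFT is taken in the variable $z$ (with $a$ fixed) and evaluated at $a\omega$, and where the value $C_\psi$ is a constant, i.e. the same for a.e. $\omega$. *)

theory Defs
  imports "HOL-Analysis.Analysis"
begin

text \<open>A parameter tuple \<open>(A, B, C, D, p, q)\<close> stands for the parameter set \<open>(A, B, C, D : p, q)\<close>.\<close>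

type_synonym saft_params = "real \<times> real \<times> real \<times> real \<times> real \<times> real"

definition square_integrable :: "'a measure \<Rightarrow> ('a \<Rightarrow> complex) \<Rightarrow> bool" where
  "square_integrable N f \<longleftrightarrow>
     f \<in> borel_measurable N \<and> integrable N (\<lambda>x. (cmod (f x))\<^sup>2)"

definition L2_inner :: "'a measure \<Rightarrow> ('a \<Rightarrow> complex) \<Rightarrow> ('a \<Rightarrow> complex) \<Rightarrow> complex" where
  "L2_inner N f g = (\<integral>x. f x * cnj (g x) \<partial>N)"

definition L2_lim :: "'a measure \<Rightarrow> (nat \<Rightarrow> 'a \<Rightarrow> complex) \<Rightarrow> ('a \<Rightarrow> complex) \<Rightarrow> bool" where
  "L2_lim N u f \<longleftrightarrow>
     (\<lambda>n. \<integral>\<^sup>+x. ennreal ((cmod (u n x - f x))\<^sup>2) \<partial>N) \<longlonglongrightarrow> 0"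

fun saft_kernel :: "saft_params \<Rightarrow> real \<Rightarrow> real \<Rightarrow> complex" where
  "saft_kernel (A, B, C, D, p, q) t \<omega> =
     1 / csqrt (\<i> * of_real (2 * pi * B)) *
     exp (\<i> / of_real (2 * B) *
          of_real (A * t\<^sup>2 + 2 * t * (p - \<omega>) - 2 * \<omega> * (D * p - B * q) + D * (\<omega>\<^sup>2 + p\<^sup>2)))"

definition saft :: "saft_params \<Rightarrow> (real \<Rightarrow> complex) \<Rightarrow> real \<Rightarrow> complex" where
  "saft M f \<omega> = (\<integral>t. f t * saft_kernel M t \<omega> \<partial>lborel)"

text \<open>
  \<open>is_saft_L2 M f F\<close>: the function \<open>F\<close> represents the value at \<open>f\<close> of the \<open>L\<^sup>2\<close>-continuous
  extension of \<^const>\<open>saft\<close> from \<open>L\<^sup>1 \<inter> L\<^sup>2\<close> to \<open>L\<^sup>2\<close>. This is a relation because \<open>F\<close> is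
  determined only almost everywhere.
\<close>

definition is_saft_L2 :: "saft_params \<Rightarrow> (real \<Rightarrow> complex) \<Rightarrow> (real \<Rightarrow> complex) \<Rightarrow> bool" where
  "is_saft_L2 M f F \<longleftrightarrow>
     square_integrable lborel f \<and> square_integrable lborel F \<and>
     (\<forall>u. (\<forall>n. integrable lborel (u n) \<and> square_integrable lborel (u n)) \<and> L2_lim lborel u f
        \<longrightarrow> L2_lim lborel (\<lambda>n. saft M (u n)) F)"

fun sa_wavelet :: "saft_params \<Rightarrow> (real \<Rightarrow> complex) \<Rightarrow> real \<Rightarrow> real \<Rightarrow> real \<Rightarrow> complex" where
  "sa_wavelet (A, B, C, D, p, q) \<psi> b a t =
     1 / csqrt (\<i> * of_real (2 * pi * a * B)) * \<psi> ((t - b) / a) *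
     exp (- (\<i> / of_real (2 * B)) * of_real (A * t\<^sup>2 + D * p\<^sup>2 - A * (b / a)\<^sup>2))"

definition sa_wavelet_transform ::
    "saft_params \<Rightarrow> (real \<Rightarrow> complex) \<Rightarrow> (real \<Rightarrow> complex) \<Rightarrow> real \<Rightarrow> real \<Rightarrow> complex" where
  "sa_wavelet_transform M \<psi> g b a = (\<integral>t. g t * cnj (sa_wavelet M \<psi> b a t) \<partial>lborel)"

fun admissibility_fun :: "saft_params \<Rightarrow> (real \<Rightarrow> complex) \<Rightarrow> real \<Rightarrow> real \<Rightarrow> complex" where
  "admissibility_fun (A, B, C, D, p, q) \<psi> a z =
     exp (\<i> / of_real (2 * B) * of_real (2 * z * p * (a - 1) - A * z\<^sup>2)) * cnj (\<psi> (- z))"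

text \<open>
  \<open>admissible_with_constant M \<psi> c\<close>: the wavelet \<open>\<psi>\<close> is admissible and its constant is \<open>c\<close>.
  For each \<open>a > 0\<close> the \<open>L\<^sup>2\<close> transform is defined only up to a null set depending on \<open>a\<close>, so the
  integral over \<open>a\<close> at fixed \<open>\<omega>\<close> is formed with a jointly measurable choice \<open>G\<close> of
  representatives. By Fubini, two such choices give the same integral for almost every \<open>\<omega>\<close>.
  The condition \<open>0 \<le> c\<close> is needed because \<^const>\<open>ennreal\<close> sends negative reals to \<open>0\<close>.
\<close>

definition admissible_with_constant :: "saft_params \<Rightarrow> (real \<Rightarrow> complex) \<Rightarrow> real \<Rightarrow> bool" where
  "admissible_with_constant M \<psi> c \<longleftrightarrow> 0 \<le> c \<and>
     (\<exists>G. (\<lambda>(a, \<omega>). G a \<omega>) \<in> borel_measurable (lborel \<Otimes>\<^sub>M lborel) \<and>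
          (\<forall>a>0. is_saft_L2 M (admissibility_fun M \<psi> a) (G a)) \<and>
          (AE \<omega> in lborel.
             (\<integral>\<^sup>+a\<in>{0<..}. ennreal (1 / a * (cmod (G a (a * \<omega>)))\<^sup>2) \<partial>lborel) = ennreal c))"

text \<open>The measure \<open>db da / a\<^sup>2\<close> on pairs \<open>(b, a)\<close> with \<open>a > 0\<close>.\<close>

definition half_plane_measure :: "(real \<times> real) measure" where
  "half_plane_measure =
     density (restrict_space (lborel \<Otimes>\<^sub>M lborel) (UNIV \<times> {0<..})) (\<lambda>(b, a). ennreal (1 / a\<^sup>2))"

end

theory Submission
  imports Defs "HOL-Probability.Characteristic_Functions"
begin

text \<open>
  The wavelet transform \<open>W\<close> satisfies \<open>\<parallel>W g\<parallel>\<^sup>2 = C\<^sub>\<psi> \<parallel>g\<parallel>\<^sup>2\<close>, where the first norm is that of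
  \<open>L\<^sup>2(db da / a\<^sup>2)\<close> and the second that of \<open>L\<^sup>2(\<real>)\<close>. Everything else is Hilbert space geometry.
  By polarisation \<open>\<langle>W g, W k\<rangle> = C\<^sub>\<psi> \<langle>g, k\<rangle>\<close> (\<open>wavelet_transform_inner\<close>). The integral in the theorem is
  \<open>\<langle>f, W \<psi>\<^sub>b\<^sub>'\<^sub>,\<^sub>a\<^sub>'\<rangle>\<close>, and \<open>\<langle>g, \<psi>\<^sub>b\<^sub>'\<^sub>,\<^sub>a\<^sub>'\<rangle> = W g (b', a')\<close> by definition. So if \<open>f = W g\<close>, the integral is
  \<open>C\<^sub>\<psi> f(b', a')\<close>. Conversely the range of \<open>W\<close> is complete, because \<open>W\<close> is a multiple of an isometry
  and \<open>L\<^sup>2(\<real>)\<close> is complete; let \<open>W g\<close> be the orthogonal projection of \<open>f\<close> onto this range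
  (\<open>L2_projection\<close>). The integral depends on \<open>f\<close> only through \<open>W g\<close>, hence equals
  \<open>C\<^sub>\<psi> W g (b', a')\<close>, and the integral equation says \<open>f = W g\<close>.

  The norm identity comes from the Fourier transform. For fixed \<open>a\<close> the function \<open>b \<mapsto> W g (b, a)\<close> is,
  up to a factor of modulus \<open>(2 \<pi> a |B|)\<^sup>-\<^sup>1\<^sup>/\<^sup>2\<close>, the convolution of the chirped signal
  \<open>h(t) = exp(i A t\<^sup>2 / (2 B)) g(t)\<close> with the reflected, conjugated and dilated wavelet, and the Fourier
  transform of the latter at \<open>(\<omega> - p) / B\<close> has, up to a factor independent of \<open>\<omega>\<close>, the modulus of the
  transform that occurs in the admissibility condition, taken at \<open>a \<omega>\<close> (\<open>saft_admissibility_fun\<close>). Plancherel's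
  identity turns the energy of the slice into an integral over \<open>\<omega>\<close> (\<open>fixed_scale_energy\<close>), and
  integrating over \<open>a\<close> with Tonelli's theorem produces \<open>C\<^sub>\<psi>\<close>.

  Plancherel's identity is proved for continuous, bounded, integrable functions, by Gaussian
  summation. These functions are dense in \<open>L\<^sup>2(\<real>)\<close>, and convolving one of them with an integrable
  function gives another. General wavelets
  and general signals are reached by two applications of the same limit argument
  (\<open>L2_isometry_limit\<close>): an identity between norms survives an \<open>L\<^sup>2\<close> limit on one side as soon as the
  other side converges pointwise, by Fatou's lemma.
\<close>

section \<open>Square-integrable functions\<close>

lemma borel_measurable_cnj [measurable]: "cnj \<in> borel_measurable borel"
  by (intro borel_measurable_continuous_onI continuous_intros)

lemma borel_measurable_cis [measurable]: "cis \<in> borel_measurable borel"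
  by (intro borel_measurable_continuous_onI continuous_intros)

lemma borel_measurable_csqrt [measurable]: "csqrt \<in> borel_measurable borel"
proof -
  have csqrt_eq: "csqrt = (\<lambda>z. complex_of_real (sqrt ((cmod z + Re z) / 2))
      + \<i> * complex_of_real ((if Im z = 0 then 1 else sgn (Im z)) * sqrt ((cmod z - Re z) / 2)))"
    by (rule ext) (simp add: complex_eq_iff)
  show ?thesis unfolding csqrt_eq by measurable
qed

text \<open>
  The squared norm is used in two forms. The extended one makes sense for every measurable function
  and suits Tonelli and Fatou arguments; the real one suits Hilbert space geometry.
\<close>

definition L2_energy :: "'a measure \<Rightarrow> ('a \<Rightarrow> complex) \<Rightarrow> ennreal" where
  "L2_energy N f = (\<integral>\<^sup>+x. ennreal ((cmod (f x))\<^sup>2) \<partial>N)"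

definition L2_sqnorm :: "'a measure \<Rightarrow> ('a \<Rightarrow> complex) \<Rightarrow> real" where
  "L2_sqnorm N f = (\<integral>x. (cmod (f x))\<^sup>2 \<partial>N)"

lemma L2_lim_energy: "L2_lim N u f \<longleftrightarrow> (\<lambda>n. L2_energy N (\<lambda>x. u n x - f x)) \<longlonglongrightarrow> 0"
  by (simp add: L2_lim_def L2_energy_def)

lemma square_integrable_measurable [measurable_dest]:
  "square_integrable N f \<Longrightarrow> f \<in> borel_measurable N"
  by (simp add: square_integrable_def)

lemma square_integrable_energy_iff:
  "square_integrable N f \<longleftrightarrow> f \<in> borel_measurable N \<and> L2_energy N f < \<infinity>"
  unfolding square_integrable_def L2_energy_def
  by (auto simp: integrable_iff_bounded)

lemma energy_eq_sqnorm:
  assumes "square_integrable N f"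
  shows "L2_energy N f = ennreal (L2_sqnorm N f)"
  using assms unfolding square_integrable_def L2_energy_def L2_sqnorm_def
  by (intro nn_integral_eq_integral) auto

lemma L2_sqnorm_nonneg [simp]: "0 \<le> L2_sqnorm N f"
  by (simp add: L2_sqnorm_def)

lemma cmod_add_squared_le: "(cmod (x + y))\<^sup>2 \<le> 2 * (cmod x)\<^sup>2 + 2 * (cmod y)\<^sup>2"
proof -
  have "(cmod (x + y))\<^sup>2 \<le> (cmod x + cmod y)\<^sup>2"
    by (simp add: norm_triangle_ineq)
  also have "\<dots> \<le> 2 * (cmod x)\<^sup>2 + 2 * (cmod y)\<^sup>2"
    using sum_squares_bound[of "cmod x" "cmod y"] by (simp add: power2_sum)
  finally show ?thesis .
qed

lemma energy_add_le:
  assumes [measurable]: "f \<in> borel_measurable N" "g \<in> borel_measurable N"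
  shows "L2_energy N (\<lambda>x. f x + g x) \<le> 2 * L2_energy N f + 2 * L2_energy N g"
proof -
  have "L2_energy N (\<lambda>x. f x + g x)
      \<le> (\<integral>\<^sup>+x. 2 * ennreal ((cmod (f x))\<^sup>2) + 2 * ennreal ((cmod (g x))\<^sup>2) \<partial>N)"
    unfolding L2_energy_def
  proof (rule nn_integral_mono)
    fix x
    have "ennreal ((cmod (f x + g x))\<^sup>2) \<le> ennreal (2 * (cmod (f x))\<^sup>2 + 2 * (cmod (g x))\<^sup>2)"
      by (intro ennreal_leI cmod_add_squared_le)
    then show "ennreal ((cmod (f x + g x))\<^sup>2) \<le> 2 * ennreal ((cmod (f x))\<^sup>2) + 2 * ennreal ((cmod (g x))\<^sup>2)"
      by (simp add: ennreal_plus ennreal_mult)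
  qed
  also have "\<dots> = 2 * L2_energy N f + 2 * L2_energy N g"
    by (simp add: L2_energy_def nn_integral_add nn_integral_cmult)
  finally show ?thesis .
qed

lemma energy_cmult:
  assumes [measurable]: "f \<in> borel_measurable N"
  shows "L2_energy N (\<lambda>x. c * f x) = ennreal ((cmod c)\<^sup>2) * L2_energy N f"
  by (simp add: L2_energy_def norm_mult power_mult_distrib ennreal_mult nn_integral_cmult)

lemma energy_diff_le:
  assumes [measurable]: "f \<in> borel_measurable N" "g \<in> borel_measurable N"
  shows "L2_energy N (\<lambda>x. f x - g x) \<le> 2 * L2_energy N f + 2 * L2_energy N g"
  using energy_add_le[of f N "\<lambda>x. - g x"] by (simp add: L2_energy_def)

lemma square_integrable_add:
  assumes "square_integrable N f" "square_integrable N g"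
  shows "square_integrable N (\<lambda>x. f x + g x)"
proof -
  have [measurable]: "f \<in> borel_measurable N" "g \<in> borel_measurable N"
    using assms by (auto simp: square_integrable_def)
  have "2 * L2_energy N f + 2 * L2_energy N g < \<infinity>"
    using assms by (auto simp: square_integrable_energy_iff ennreal_mult_less_top less_top)
  then show ?thesis
    using energy_add_le[of f N g] unfolding square_integrable_energy_iff
    by (auto intro: le_less_trans)
qed

lemma square_integrable_cmult:
  assumes "square_integrable N f"
  shows "square_integrable N (\<lambda>x. c * f x)"
  using assms energy_cmult[of f N c]
  by (auto simp: square_integrable_energy_iff ennreal_mult_less_top less_top)

lemma square_integrable_diff:
  assumes "square_integrable N f" "square_integrable N g"
  shows "square_integrable N (\<lambda>x. f x - g x)"
  using square_integrable_add[OF assms(1) square_integrable_cmult[OF assms(2), of "-1"]] by simp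

lemma square_integrable_bounded_mult:
  assumes "square_integrable N f" and [measurable]: "m \<in> borel_measurable N"
    and m: "\<And>x. cmod (m x) \<le> K"
  shows "square_integrable N (\<lambda>x. m x * f x)"
  unfolding square_integrable_def
proof
  have [measurable]: "f \<in> borel_measurable N" and f: "integrable N (\<lambda>x. (cmod (f x))\<^sup>2)"
    using assms by (auto simp: square_integrable_def)
  show "(\<lambda>x. m x * f x) \<in> borel_measurable N" by measurable
  show "integrable N (\<lambda>x. (cmod (m x * f x))\<^sup>2)"
  proof (rule Bochner_Integration.integrable_bound)
    show "integrable N (\<lambda>x. K\<^sup>2 * (cmod (f x))\<^sup>2)" using f by simp
    show "AE x in N. norm ((cmod (m x * f x))\<^sup>2) \<le> norm (K\<^sup>2 * (cmod (f x))\<^sup>2)"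
      using m by (auto simp: norm_mult power_mult_distrib intro!: mult_right_mono power_mono)
  qed measurable
qed

lemma square_integrable_inner_integrable:
  assumes "square_integrable N f" "square_integrable N g"
  shows "integrable N (\<lambda>x. f x * cnj (g x))"
proof -
  have [measurable]: "f \<in> borel_measurable N" "g \<in> borel_measurable N"
    using assms by (auto simp: square_integrable_def)
  show ?thesis
  proof (rule Bochner_Integration.integrable_bound)
    show "integrable N (\<lambda>x. (cmod (f x))\<^sup>2 + (cmod (g x))\<^sup>2)"
      using assms by (auto simp: square_integrable_def)
    have "norm (f x * cnj (g x)) \<le> norm ((cmod (f x))\<^sup>2 + (cmod (g x))\<^sup>2)" for x
    proof -
      have "2 * cmod (f x) * cmod (g x) \<le> (cmod (f x))\<^sup>2 + (cmod (g x))\<^sup>2"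
        by (rule sum_squares_bound)
      moreover have "0 \<le> cmod (f x) * cmod (g x)" by simp
      ultimately have "cmod (f x) * cmod (g x) \<le> (cmod (f x))\<^sup>2 + (cmod (g x))\<^sup>2" by linarith
      then show ?thesis by (simp add: norm_mult)
    qed
    then show "AE x in N. norm (f x * cnj (g x)) \<le> norm ((cmod (f x))\<^sup>2 + (cmod (g x))\<^sup>2)" by simp
  qed measurable
qed

lemma L2_inner_self: "L2_inner N f f = of_real (L2_sqnorm N f)"
  by (simp add: L2_inner_def L2_sqnorm_def complex_norm_square[symmetric] flip: of_real_power)

lemma L2_inner_commute: "L2_inner N g f = cnj (L2_inner N f g)"
  unfolding L2_inner_def by (subst Bochner_Integration.integral_cnj[symmetric]) (simp add: mult.commute)

lemma L2_inner_add_left: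
  assumes "square_integrable N f" "square_integrable N g" "square_integrable N h"
  shows "L2_inner N (\<lambda>x. f x + g x) h = L2_inner N f h + L2_inner N g h"
  unfolding L2_inner_def using assms
  by (simp add: distrib_right square_integrable_inner_integrable)

lemma L2_inner_diff_left:
  assumes "square_integrable N f" "square_integrable N g" "square_integrable N h"
  shows "L2_inner N (\<lambda>x. f x - g x) h = L2_inner N f h - L2_inner N g h"
  unfolding L2_inner_def using assms
  by (simp add: left_diff_distrib square_integrable_inner_integrable)

lemma L2_inner_cmult_left:
  shows "L2_inner N (\<lambda>x. c * f x) h = c * L2_inner N f h"
  unfolding L2_inner_def by (simp add: mult.assoc)

lemma L2_inner_cmult_right:
  shows "L2_inner N h (\<lambda>x. c * f x) = cnj c * L2_inner N h f"
  unfolding L2_inner_def by (simp add: mult.left_commute)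

lemma L2_sqnorm_add:
  assumes "square_integrable N f" "square_integrable N g"
  shows "L2_sqnorm N (\<lambda>x. f x + g x) = L2_sqnorm N f + L2_sqnorm N g + 2 * Re (L2_inner N f g)"
proof -
  have *: "(cmod (f x + g x))\<^sup>2 = (cmod (f x))\<^sup>2 + (cmod (g x))\<^sup>2 + 2 * Re (f x * cnj (g x))" for x
    unfolding cmod_power2 by (simp add: power2_eq_square algebra_simps)
  have "L2_sqnorm N (\<lambda>x. f x + g x)
     = (\<integral>x. (cmod (f x))\<^sup>2 + (cmod (g x))\<^sup>2 + 2 * Re (f x * cnj (g x)) \<partial>N)"
    unfolding L2_sqnorm_def * ..
  also have "\<dots> = L2_sqnorm N f + L2_sqnorm N g + 2 * (\<integral>x. Re (f x * cnj (g x)) \<partial>N)"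
    using assms square_integrable_inner_integrable[OF assms]
    unfolding L2_sqnorm_def square_integrable_def
    by (subst Bochner_Integration.integral_add; (subst Bochner_Integration.integral_add)?)
       (auto intro!: integrable_Re simp del: times_complex.sel)
  also have "(\<integral>x. Re (f x * cnj (g x)) \<partial>N) = Re (L2_inner N f g)"
    unfolding L2_inner_def by (rule integral_Re[OF square_integrable_inner_integrable[OF assms]])
  finally show ?thesis .
qed

lemma L2_sqnorm_cmult: "L2_sqnorm N (\<lambda>x. c * f x) = (cmod c)\<^sup>2 * L2_sqnorm N f"
  by (simp add: L2_sqnorm_def norm_mult power_mult_distrib)

lemma L2_sqnorm_diff:
  assumes "square_integrable N f" "square_integrable N g"
  shows "L2_sqnorm N (\<lambda>x. f x - g x) = L2_sqnorm N f + L2_sqnorm N g - 2 * Re (L2_inner N f g)"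
  using L2_sqnorm_add[OF assms(1) square_integrable_cmult[OF assms(2), of "-1"]]
  by (simp add: L2_sqnorm_cmult[of N "-1" g, simplified] L2_inner_cmult_right[of N f "-1" g, simplified])

lemma L2_Cauchy_Schwarz:
  assumes "square_integrable N f" "square_integrable N g"
  shows "(cmod (L2_inner N f g))\<^sup>2 \<le> L2_sqnorm N f * L2_sqnorm N g"
proof -
  have [measurable]: "f \<in> borel_measurable N" "g \<in> borel_measurable N"
    using assms by (auto simp: square_integrable_def)
  have "ennreal (cmod (L2_inner N f g)) \<le> (\<integral>\<^sup>+x. ennreal (norm (f x * cnj (g x))) \<partial>N)"
    unfolding L2_inner_def
    by (rule integral_norm_bound_ennreal[OF square_integrable_inner_integrable[OF assms]])
  also have "\<dots> = (\<integral>\<^sup>+x. ennreal (cmod (f x)) * ennreal (cmod (g x)) \<partial>N)"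
    by (simp add: norm_mult ennreal_mult)
  finally have "(ennreal (cmod (L2_inner N f g)))\<^sup>2
      \<le> (\<integral>\<^sup>+x. ennreal (cmod (f x)) * ennreal (cmod (g x)) \<partial>N)\<^sup>2"
    by (intro power_mono) auto
  also have "\<dots> \<le> (\<integral>\<^sup>+x. (ennreal (cmod (f x)))\<^sup>2 \<partial>N) * (\<integral>\<^sup>+x. (ennreal (cmod (g x)))\<^sup>2 \<partial>N)"
    by (intro Cauchy_Schwarz_nn_integral) auto
  also have "\<dots> = L2_energy N f * L2_energy N g"
    by (simp add: L2_energy_def ennreal_power)
  also have "\<dots> = ennreal (L2_sqnorm N f * L2_sqnorm N g)"
    using assms by (simp add: energy_eq_sqnorm ennreal_mult)
  finally show ?thesis
    by (simp add: ennreal_power)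
qed

lemma L2_energy_cong_AE:
  "AE x in N. f x = g x \<Longrightarrow> L2_energy N f = L2_energy N g"
  unfolding L2_energy_def by (rule nn_integral_cong_AE) (auto elim: eventually_mono)

lemma L2_sqnorm_cong_AE:
  assumes "AE x in N. f x = g x" "f \<in> borel_measurable N" "g \<in> borel_measurable N"
  shows "L2_sqnorm N f = L2_sqnorm N g"
  unfolding L2_sqnorm_def using assms by (intro integral_cong_AE) auto

lemma L2_inner_cong_AE:
  assumes "AE x in N. f x = g x" "square_integrable N f" "square_integrable N g" "square_integrable N e"
  shows "L2_inner N f e = L2_inner N g e"
  unfolding L2_inner_def
proof (rule integral_cong_AE)
  show "AE x in N. f x * cnj (e x) = g x * cnj (e x)" using assms(1) by eventually_elim simp
qed (use assms in \<open>auto intro: borel_measurable_integrable[OF square_integrable_inner_integrable]\<close>)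

lemma L2_lim_sqnorm_iff:
  assumes "\<And>n. square_integrable N (u n)" "square_integrable N f"
  shows "L2_lim N u f \<longleftrightarrow> (\<lambda>n. L2_sqnorm N (\<lambda>x. u n x - f x)) \<longlonglongrightarrow> 0"
proof -
  have "L2_energy N (\<lambda>x. u n x - f x) = ennreal (L2_sqnorm N (\<lambda>x. u n x - f x))" for n
    by (intro energy_eq_sqnorm square_integrable_diff assms)
  then show ?thesis
    unfolding L2_lim_energy using tendsto_ennreal_iff[of _ sequentially 0] by simp
qed

lemma L2_lim_inner_left:
  assumes u: "\<And>n. square_integrable N (u n)" and f: "square_integrable N f"
    and g: "square_integrable N g" and lim: "L2_lim N u f"
  shows "(\<lambda>n. L2_inner N (u n) g) \<longlonglongrightarrow> L2_inner N f g"
proof -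
  have "(\<lambda>n. L2_inner N (u n) g - L2_inner N f g) \<longlonglongrightarrow> 0"
  proof (rule Lim_null_comparison)
    show "\<forall>\<^sub>F n in sequentially. norm (L2_inner N (u n) g - L2_inner N f g)
        \<le> sqrt (L2_sqnorm N (\<lambda>x. u n x - f x) * L2_sqnorm N g)"
    proof (rule always_eventually, rule allI, rule real_le_rsqrt)
      fix n
      show "(norm (L2_inner N (u n) g - L2_inner N f g))\<^sup>2 \<le> L2_sqnorm N (\<lambda>x. u n x - f x) * L2_sqnorm N g"
        using L2_Cauchy_Schwarz[OF square_integrable_diff[OF u f] g, of n]
        by (simp add: L2_inner_diff_left u f g)
    qed
    have "(\<lambda>n. sqrt (L2_sqnorm N (\<lambda>x. u n x - f x) * L2_sqnorm N g)) \<longlonglongrightarrow> sqrt (0 * L2_sqnorm N g)"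
      using lim L2_lim_sqnorm_iff[OF u f] by (intro tendsto_intros) simp
    then show "(\<lambda>n. sqrt (L2_sqnorm N (\<lambda>x. u n x - f x) * L2_sqnorm N g)) \<longlonglongrightarrow> 0" by simp
  qed
  then show ?thesis by (simp add: LIM_zero_iff)
qed

lemma L2_lim_sqnorm:
  assumes u: "\<And>n. square_integrable N (u n)" and f: "square_integrable N f"
    and lim: "L2_lim N u f"
  shows "(\<lambda>n. L2_sqnorm N (u n)) \<longlonglongrightarrow> L2_sqnorm N f"
proof -
  have eq: "L2_sqnorm N (u n) = L2_sqnorm N (\<lambda>x. u n x - f x) - L2_sqnorm N f + 2 * Re (L2_inner N (u n) f)" for n
    by (simp add: L2_sqnorm_diff u f)
  have "(\<lambda>n. L2_sqnorm N (\<lambda>x. u n x - f x) - L2_sqnorm N f + 2 * Re (L2_inner N (u n) f))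
      \<longlonglongrightarrow> 0 - L2_sqnorm N f + 2 * Re (L2_inner N f f)"
    using lim L2_lim_sqnorm_iff[OF u f] L2_lim_inner_left[OF u f f lim]
    by (intro tendsto_intros) auto
  then show ?thesis
    unfolding eq[symmetric] by (simp add: L2_inner_self)
qed

lemma L2_lim_energy_tendsto:
  assumes u: "\<And>n. square_integrable N (u n)" and f: "square_integrable N f"
    and lim: "L2_lim N u f"
  shows "(\<lambda>n. L2_energy N (u n)) \<longlonglongrightarrow> L2_energy N f"
  unfolding energy_eq_sqnorm[OF u] energy_eq_sqnorm[OF f]
  using L2_lim_sqnorm[OF assms] by (intro tendsto_ennrealI)

lemma L2_lim_dominated:
  assumes [measurable]: "\<And>n. u n \<in> borel_measurable N" "f \<in> borel_measurable N" "w \<in> borel_measurable N"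
    and w: "integrable N (\<lambda>x. (w x :: real)\<^sup>2)"
    and ptw: "AE x in N. (\<lambda>n. u n x) \<longlonglongrightarrow> f x"
    and dom: "\<And>n. AE x in N. cmod (u n x) \<le> w x"
  shows "L2_lim N u f"
proof -
  have dom': "AE x in N. \<forall>n. cmod (u n x) \<le> w x" using dom by (simp add: AE_all_countable)
  have "(\<lambda>n. \<integral>\<^sup>+x. ennreal ((cmod (u n x - f x))\<^sup>2) \<partial>N) \<longlonglongrightarrow> (\<integral>\<^sup>+x. 0 \<partial>N)"
  proof (rule nn_integral_dominated_convergence[where w="\<lambda>x. ennreal (4 * (w x)\<^sup>2)"])
    show "AE x in N. ennreal ((cmod (u n x - f x))\<^sup>2) \<le> ennreal (4 * (w x)\<^sup>2)" for n
      using dom' ptw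
    proof eventually_elim
      fix x assume *: "\<forall>n. cmod (u n x) \<le> w x" "(\<lambda>n. u n x) \<longlonglongrightarrow> f x"
      then have "cmod (f x) \<le> w x"
        by (intro LIMSEQ_le_const2[OF tendsto_norm]) auto
      then have "cmod (u n x - f x) \<le> 2 * w x"
        using * norm_triangle_ineq4[of "u n x" "f x"] by (smt (verit))
      then have "(cmod (u n x - f x))\<^sup>2 \<le> (2 * w x)\<^sup>2" by (intro power_mono) auto
      then show "ennreal ((cmod (u n x - f x))\<^sup>2) \<le> ennreal (4 * (w x)\<^sup>2)"
        by (intro ennreal_leI) (simp add: power_mult_distrib)
    qed
    show "(\<integral>\<^sup>+x. ennreal (4 * (w x)\<^sup>2) \<partial>N) < \<infinity>"
      using integrable_mult_right[OF w, of 4] unfolding integrable_iff_bounded by (simp only: norm_mult norm_power real_norm_def) (simp add: abs_mult)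
    show "AE x in N. (\<lambda>n. ennreal ((cmod (u n x - f x))\<^sup>2)) \<longlonglongrightarrow> 0"
      using ptw
    proof eventually_elim
      fix x assume "(\<lambda>n. u n x) \<longlonglongrightarrow> f x"
      then have "(\<lambda>n. (cmod (u n x - f x))\<^sup>2) \<longlonglongrightarrow> (cmod (f x - f x))\<^sup>2"
        by (intro tendsto_intros)
      then have "(\<lambda>n. ennreal ((cmod (u n x - f x))\<^sup>2)) \<longlonglongrightarrow> ennreal ((cmod (f x - f x))\<^sup>2)"
        by (rule tendsto_ennrealI)
      then show "(\<lambda>n. ennreal ((cmod (u n x - f x))\<^sup>2)) \<longlonglongrightarrow> 0" by simp
    qed
  qed measurable
  then show ?thesis by (simp add: L2_lim_def)
qed

lemma energy_le_liminf:
  assumes y [measurable]: "\<And>n. y n \<in> borel_measurable N" and "y' \<in> borel_measurable N"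
    and ptw: "AE t in N. (\<lambda>n. y n t) \<longlonglongrightarrow> y' t"
  shows "L2_energy N y' \<le> liminf (\<lambda>n. L2_energy N (y n))"
proof -
  have "L2_energy N y' = (\<integral>\<^sup>+t. liminf (\<lambda>n. ennreal ((cmod (y n t))\<^sup>2)) \<partial>N)"
    unfolding L2_energy_def
  proof (rule nn_integral_cong_AE, use ptw in eventually_elim)
    fix t assume "(\<lambda>n. y n t) \<longlonglongrightarrow> y' t"
    then have "(\<lambda>n. ennreal ((cmod (y n t))\<^sup>2)) \<longlonglongrightarrow> ennreal ((cmod (y' t))\<^sup>2)"
      by (intro tendsto_intros tendsto_ennrealI)
    then show "ennreal ((cmod (y' t))\<^sup>2) = liminf (\<lambda>n. ennreal ((cmod (y n t))\<^sup>2))"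
      by (rule lim_imp_Liminf[OF trivial_limit_sequentially, symmetric])
  qed
  also have "\<dots> \<le> liminf (\<lambda>n. L2_energy N (y n))"
    unfolding L2_energy_def by (intro nn_integral_liminf) measurable
  finally show ?thesis .
qed

text \<open>
  Suppose that a linear map multiplies squared norms by \<open>c\<close> on a sequence \<open>x n\<close> and on its differences,
  and that the images \<open>y n\<close> converge pointwise to the expected image of the limit. The differences
  \<open>y n - y m\<close> are small in norm because the \<open>x n\<close> converge, so Fatou's lemma in \<open>m\<close> shows that \<open>y n\<close>
  converges to the pointwise limit in norm as well. The map itself does not appear in the
  statement, which therefore applies to maps given by integrals that are defined only pointwise.
\<close>

lemma L2_isometry_limit:
  assumes x: "\<And>n. square_integrable N (x n)" "square_integrable N x'" "L2_lim N x x'"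
    and y: "\<And>n. y n \<in> borel_measurable N'" and y': "y' \<in> borel_measurable N'"
    and ptw: "AE t in N'. (\<lambda>n. y n t) \<longlonglongrightarrow> y' t"
    and iso: "\<And>n. L2_energy N' (y n) = ennreal c * L2_energy N (x n)"
    and iso_diff: "\<And>n m. L2_energy N' (\<lambda>t. y n t - y m t) = ennreal c * L2_energy N (\<lambda>t. x n t - x m t)"
  shows "square_integrable N' y'" and "L2_energy N' y' = ennreal c * L2_energy N x'"
proof -
  note [measurable] = y y'
  note [measurable (raw)] = x(1,2)[THEN square_integrable_measurable]
  define e where "e n = L2_energy N (\<lambda>t. x n t - x' t)" for n
  have e0: "e \<longlonglongrightarrow> 0" using x(3) by (simp add: L2_lim_energy e_def[abs_def])
  have bound: "L2_energy N' (\<lambda>t. y n t - y' t) \<le> ennreal c * (2 * e n)" for n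
  proof -
    have "L2_energy N' (\<lambda>t. y n t - y' t) \<le> liminf (\<lambda>m. L2_energy N' (\<lambda>t. y n t - y m t))"
    proof (rule energy_le_liminf)
      show "AE t in N'. (\<lambda>m. y n t - y m t) \<longlonglongrightarrow> y n t - y' t"
        using ptw by eventually_elim (intro tendsto_intros)
    qed measurable
    \<comment> \<open>both \<open>x n\<close> and \<open>x m\<close> are compared with the limit \<open>x'\<close>\<close>
    also have "\<dots> \<le> liminf (\<lambda>m. ennreal c * (2 * e n + 2 * e m))"
    proof (rule Liminf_mono, rule always_eventually, rule allI)
      fix m
      have "L2_energy N (\<lambda>t. x n t - x m t) = L2_energy N (\<lambda>t. (x n t - x' t) - (x m t - x' t))"
        by simp
      also have "\<dots> \<le> 2 * e n + 2 * e m"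
        unfolding e_def by (rule energy_diff_le) measurable
      finally show "L2_energy N' (\<lambda>t. y n t - y m t) \<le> ennreal c * (2 * e n + 2 * e m)"
        unfolding iso_diff by (rule mult_left_mono) simp
    qed
    also have "(\<lambda>m. ennreal c * (2 * e n + 2 * e m)) \<longlonglongrightarrow> ennreal c * (2 * e n + 2 * 0)"
      by (intro tendsto_intros ennreal_tendsto_cmult e0) auto
    then have "liminf (\<lambda>m. ennreal c * (2 * e n + 2 * e m)) = ennreal c * (2 * e n)"
      by (simp add: lim_imp_Liminf)
    finally show ?thesis .
  qed
  have e_scaled: "(\<lambda>n. ennreal c * (2 * e n)) \<longlonglongrightarrow> ennreal c * (2 * 0)"
    by (intro ennreal_tendsto_cmult e0) auto
  have "(\<lambda>n. L2_energy N' (\<lambda>t. y n t - y' t)) \<longlonglongrightarrow> 0"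
    by (rule tendsto_sandwich[OF _ _ tendsto_const e_scaled[simplified]])
       (use bound in \<open>auto intro!: always_eventually\<close>)
  then have lim: "L2_lim N' y y'" by (simp add: L2_lim_energy)
  have yn: "square_integrable N' (y n)" for n
    using x(1)[of n] unfolding square_integrable_energy_iff iso
    by (auto simp: ennreal_mult_less_top)
  have "square_integrable N' (\<lambda>t. y 0 t - y' t)"
  proof -
    have "e 0 < \<infinity>"
      using square_integrable_diff[OF x(1)[of 0] x(2)]
      by (simp add: e_def square_integrable_energy_iff)
    then have "ennreal c * (2 * e 0) < \<infinity>" by (simp add: ennreal_mult_less_top)
    then show ?thesis using bound[of 0] by (auto simp: square_integrable_energy_iff)
  qed
  from square_integrable_diff[OF yn[of 0] this] show y'sq: "square_integrable N' y'" by simp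
  have "(\<lambda>n. L2_energy N' (y n)) \<longlonglongrightarrow> L2_energy N' y'"
    by (rule L2_lim_energy_tendsto[OF yn y'sq lim])
  moreover have "(\<lambda>n. ennreal c * L2_energy N (x n)) \<longlonglongrightarrow> ennreal c * L2_energy N x'"
    by (intro ennreal_tendsto_cmult L2_lim_energy_tendsto x) auto
  ultimately show "L2_energy N' y' = ennreal c * L2_energy N x'"
    unfolding iso by (rule LIMSEQ_unique)
qed


lemma energy_affine:
  fixes c t :: real
  assumes [measurable]: "f \<in> borel_measurable borel" and c: "c \<noteq> 0"
  shows "L2_energy lborel f = ennreal \<bar>c\<bar> * L2_energy lborel (\<lambda>x. f (t + c * x))"
  unfolding L2_energy_def using c by (subst nn_integral_real_affine[of _ c t]) auto

lemma square_integrable_affine: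
  fixes c t :: real
  assumes f: "square_integrable lborel f" and c: "c \<noteq> 0"
  shows "square_integrable lborel (\<lambda>x. f (t + c * x))"
proof -
  have [measurable]: "f \<in> borel_measurable borel" using f by (simp add: square_integrable_def)
  have "ennreal \<bar>c\<bar> * L2_energy lborel (\<lambda>x. f (t + c * x)) < \<infinity>"
    using f energy_affine[of f c t] c by (simp add: square_integrable_energy_iff)
  then have "L2_energy lborel (\<lambda>x. f (t + c * x)) < \<infinity>"
    using c by (auto simp: ennreal_mult_less_top)
  then show ?thesis by (simp add: square_integrable_energy_iff)
qed

definition L2_Cauchy :: "'a measure \<Rightarrow> (nat \<Rightarrow> 'a \<Rightarrow> complex) \<Rightarrow> bool" where
  "L2_Cauchy N u \<longleftrightarrow> (\<forall>e>0. \<exists>M. \<forall>i\<ge>M. \<forall>j\<ge>M. L2_sqnorm N (\<lambda>x. u i x - u j x) < e)"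

text \<open>
  Multiplication by a strictly positive square-integrable weight turns an \<open>L\<^sup>2\<close> Cauchy sequence into
  an \<open>L\<^sup>1\<close> Cauchy sequence, by the Cauchy-Schwarz inequality. An \<open>L\<^sup>1\<close> Cauchy sequence has a subsequence
  that is pointwise Cauchy almost everywhere, and dividing by the weight gives the pointwise limit of
  the original functions; Fatou's lemma shows that it is also the \<open>L\<^sup>2\<close> limit.
\<close>

lemma L2_lborel_complete:
  fixes u :: "nat \<Rightarrow> real \<Rightarrow> complex"
  assumes u: "\<And>n. square_integrable lborel (u n)" and Cau: "L2_Cauchy lborel u"
  obtains r v where "strict_mono r" "square_integrable lborel v" "L2_lim lborel (\<lambda>n. u (r n)) v"
proof -
  note [measurable (raw)] = u[THEN square_integrable_measurable]
  define w :: "real \<Rightarrow> real" where "w x = sqrt (std_normal_density x)" for x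
  have w_pos: "w x > 0" for x by (simp add: w_def normal_density_pos)
  have [measurable]: "w \<in> borel_measurable borel" unfolding w_def[abs_def] by measurable
  have w_sq: "(cmod (complex_of_real (w x)))\<^sup>2 = std_normal_density x" for x
    by (simp add: w_def)
  have w: "square_integrable lborel (\<lambda>x. complex_of_real (w x))"
    unfolding square_integrable_def w_sq using prob_space_normal_density[of 1 0]
    by (auto simp: integrable_normal_density)
  have w_norm: "L2_sqnorm lborel (\<lambda>x. complex_of_real (w x)) = 1"
    unfolding L2_sqnorm_def w_sq by (simp add: integral_normal_density)
  define s where "s n x = complex_of_real (w x) * u n x" for n x
  have "integrable lborel (s n)" for n
    using square_integrable_inner_integrable[OF u w, of n] by (simp add: s_def[abs_def] mult.commute)
  moreover have "\<exists>M. \<forall>i\<ge>M. \<forall>j\<ge>M. (\<integral>x. norm (s i x - s j x) \<partial>lborel) < e" if "e > 0" for e :: real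
  proof -
    from Cau obtain M where M: "\<And>i j. i \<ge> M \<Longrightarrow> j \<ge> M \<Longrightarrow> L2_sqnorm lborel (\<lambda>x. u i x - u j x) < e\<^sup>2"
      unfolding L2_Cauchy_def using \<open>e > 0\<close> by (metis zero_less_power)
    have "(\<integral>x. norm (s i x - s j x) \<partial>lborel) < e" if "i \<ge> M" "j \<ge> M" for i j
    proof -
      define d where "d x = complex_of_real (cmod (u i x - u j x))" for x
      have d_norm: "L2_sqnorm lborel d = L2_sqnorm lborel (\<lambda>x. u i x - u j x)"
        by (simp add: L2_sqnorm_def d_def)
      have "d \<in> borel_measurable lborel" unfolding d_def[abs_def] by measurable
      then have d: "square_integrable lborel d"
        using square_integrable_diff[OF u[of i] u[of j]] unfolding square_integrable_def
        by (simp add: d_def)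
      have "L2_inner lborel d (\<lambda>x. complex_of_real (w x)) = complex_of_real (\<integral>x. norm (s i x - s j x) \<partial>lborel)"
        unfolding L2_inner_def integral_complex_of_real[symmetric]
      proof (intro Bochner_Integration.integral_cong refl)
        fix x
        have "s i x - s j x = complex_of_real (w x) * (u i x - u j x)"
          by (simp add: s_def right_diff_distrib)
        then show "d x * cnj (complex_of_real (w x)) = complex_of_real (norm (s i x - s j x))"
          using w_pos[of x] by (simp add: d_def norm_mult)
      qed
      then have "(\<integral>x. norm (s i x - s j x) \<partial>lborel)\<^sup>2 \<le> L2_sqnorm lborel (\<lambda>x. u i x - u j x)"
        using L2_Cauchy_Schwarz[OF d w] unfolding w_norm d_norm mult_1_right
        by (simp only: norm_of_real power2_abs)
      also have "\<dots> < e\<^sup>2" by (rule M[OF that])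
      finally show ?thesis by (rule power2_less_imp_less) (use \<open>e > 0\<close> in simp)
    qed
    then show ?thesis by blast
  qed
  ultimately obtain r where r: "strict_mono r" "AE x in lborel. Cauchy (\<lambda>i. s (r i) x)"
    using cauchy_L1_AE_cauchy_subseq[of lborel s] by blast
  define v where "v x = lim (\<lambda>i. u (r i) x)" for x
  have [measurable]: "v \<in> borel_measurable lborel"
    unfolding v_def[abs_def] by measurable
  have ptw: "AE x in lborel. (\<lambda>i. u (r i) x) \<longlonglongrightarrow> v x"
    using r(2)
  proof eventually_elim
    fix x assume "Cauchy (\<lambda>i. s (r i) x)"
    then have "convergent (\<lambda>i. inverse (complex_of_real (w x)) * s (r i) x)"
      by (intro convergent_mult convergent_const) (simp add: Cauchy_convergent_iff)
    moreover have "inverse (complex_of_real (w x)) * s (r i) x = u (r i) x" for i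
      using w_pos[of x] by (simp add: s_def)
    ultimately show "(\<lambda>i. u (r i) x) \<longlonglongrightarrow> v x"
      by (simp add: v_def convergent_LIMSEQ_iff)
  qed
  have small: "\<exists>M. \<forall>n\<ge>M. L2_energy lborel (\<lambda>x. u (r n) x - v x) \<le> ennreal e" if "e > 0" for e
  proof -
    from Cau \<open>e > 0\<close> obtain M where M: "\<And>i j. i \<ge> M \<Longrightarrow> j \<ge> M \<Longrightarrow> L2_sqnorm lborel (\<lambda>x. u i x - u j x) < e"
      unfolding L2_Cauchy_def by metis
    have "L2_energy lborel (\<lambda>x. u (r n) x - v x) \<le> ennreal e" if "n \<ge> M" for n
    proof -
      have "L2_energy lborel (\<lambda>x. u (r n) x - v x) \<le> liminf (\<lambda>m. L2_energy lborel (\<lambda>x. u (r n) x - u (r m) x))"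
      proof (rule energy_le_liminf)
        show "AE t in lborel. (\<lambda>m. u (r n) t - u (r m) t) \<longlonglongrightarrow> u (r n) t - v t"
          using ptw by eventually_elim (intro tendsto_intros)
      qed measurable
      also have "\<dots> \<le> liminf (\<lambda>m. ennreal e)"
      proof (rule Liminf_mono, rule eventually_sequentiallyI)
        fix m assume "M \<le> m"
        then have "L2_sqnorm lborel (\<lambda>x. u (r n) x - u (r m) x) < e"
          using M \<open>n \<ge> M\<close> seq_suble[OF r(1)] by (meson le_trans)
        then show "L2_energy lborel (\<lambda>x. u (r n) x - u (r m) x) \<le> ennreal e"
          by (simp add: energy_eq_sqnorm square_integrable_diff u ennreal_leI)
      qed
      finally show ?thesis by (simp add: Liminf_const)
    qed
    then show ?thesis by blast
  qed
  have v: "square_integrable lborel v"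
  proof -
    from small[of 1] obtain n where "L2_energy lborel (\<lambda>x. u (r n) x - v x) \<le> 1" by auto
    then have "L2_energy lborel (\<lambda>x. u (r n) x - v x) < \<infinity>"
      by (rule le_less_trans) simp
    moreover have "(\<lambda>x. u (r n) x - v x) \<in> borel_measurable lborel" by measurable
    ultimately have "square_integrable lborel (\<lambda>x. u (r n) x - v x)"
      unfolding square_integrable_energy_iff by blast
    from square_integrable_diff[OF u[of "r n"] this] show ?thesis by simp
  qed
  have "L2_lim lborel (\<lambda>n. u (r n)) v"
    unfolding L2_lim_sqnorm_iff[OF u v]
  proof (rule LIMSEQ_I)
    fix e :: real assume "e > 0"
    then obtain M where M: "\<And>n. n \<ge> M \<Longrightarrow> L2_energy lborel (\<lambda>x. u (r n) x - v x) \<le> ennreal (e / 2)"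
      using small[of "e / 2"] by auto
    have "norm (L2_sqnorm lborel (\<lambda>x. u (r n) x - v x) - 0) < e" if "n \<ge> M" for n
      using M[OF that] \<open>e > 0\<close>
      by (simp add: energy_eq_sqnorm square_integrable_diff u v)
    then show "\<exists>M. \<forall>n\<ge>M. norm (L2_sqnorm lborel (\<lambda>x. u (r n) x - v x) - 0) < e" by blast
  qed
  with r(1) v show thesis by (rule that)
qed

text \<open>
  The classical argument: a minimising sequence for the distance from \<open>f\<close> to \<open>V\<close> is Cauchy by the
  parallelogram law, and perturbing a minimiser in a direction \<open>e\<close> shows that the residual is orthogonal
  to \<open>e\<close>. Completeness is expressed through subsequences because the limit of any subsequence of the
  minimising sequence is already a minimiser.
\<close>

lemma L2_projection:
  assumes V: "\<And>v. v \<in> V \<Longrightarrow> square_integrable N v" and ne: "V \<noteq> {}"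
    and add: "\<And>v w. v \<in> V \<Longrightarrow> w \<in> V \<Longrightarrow> (\<lambda>x. v x + w x) \<in> V"
    and scale: "\<And>c v. v \<in> V \<Longrightarrow> (\<lambda>x. c * v x) \<in> V"
    and complete: "\<And>u. (\<And>n. u n \<in> V) \<Longrightarrow> L2_Cauchy N u \<Longrightarrow>
      \<exists>r v. strict_mono r \<and> v \<in> V \<and> L2_lim N (\<lambda>n. u (r n)) v"
    and f: "square_integrable N f"
  obtains v where "v \<in> V" "\<And>e. e \<in> V \<Longrightarrow> L2_inner N (\<lambda>x. f x - v x) e = 0"
proof -
  define J where "J v = L2_sqnorm N (\<lambda>x. f x - v x)" for v
  define d where "d = (INF v\<in>V. J v)"
  have bdd: "bdd_below (J ` V)" by (intro bdd_belowI[of _ 0]) (auto simp: J_def)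
  have d_le: "d \<le> J v" if "v \<in> V" for v
    unfolding d_def using bdd that by (rule cINF_lower)
  have "\<exists>v\<in>V. J v < d + 1 / real (Suc n)" for n
  proof -
    have "d < d + 1 / real (Suc n)" by simp
    then show ?thesis unfolding d_def[symmetric] using cINF_less_iff[OF ne bdd] d_def by metis
  qed
  then obtain u where uV: "\<And>n. u n \<in> V" and u: "\<And>n. J (u n) < d + 1 / real (Suc n)" by metis
  have usq: "square_integrable N (u n)" for n using V uV by blast
  have fusq: "square_integrable N (\<lambda>x. f x - u n x)" for n by (intro square_integrable_diff f usq)
  have parallelogram: "L2_sqnorm N (\<lambda>x. u i x - u j x) \<le> 2 / real (Suc i) + 2 / real (Suc j)" for i j
  proof -
    \<comment> \<open>the midpoint belongs to \<open>V\<close>, so it is at squared distance at least \<open>d\<close> from \<open>f\<close>\<close>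
    define m where "m x = (1/2) * (u i x + u j x)" for x
    have mV: "m \<in> V" unfolding m_def[abs_def] by (intro scale add uV)
    have "L2_sqnorm N (\<lambda>x. (f x - u j x) - (f x - u i x)) + L2_sqnorm N (\<lambda>x. (f x - u j x) + (f x - u i x))
        = 2 * J (u j) + 2 * J (u i)"
      unfolding J_def by (subst L2_sqnorm_diff[OF fusq fusq], subst L2_sqnorm_add[OF fusq fusq]) simp
    moreover have "(\<lambda>x. (f x - u j x) + (f x - u i x)) = (\<lambda>x. 2 * (f x - m x))"
      by (auto simp: m_def field_simps)
    then have "L2_sqnorm N (\<lambda>x. (f x - u j x) + (f x - u i x)) = 4 * J m"
      by (simp only: L2_sqnorm_cmult J_def) simp
    moreover have "(\<lambda>x. (f x - u j x) - (f x - u i x)) = (\<lambda>x. u i x - u j x)" by auto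
    ultimately have "L2_sqnorm N (\<lambda>x. u i x - u j x) = 2 * J (u j) + 2 * J (u i) - 4 * J m" by simp
    then show ?thesis using d_le[OF mV] u[of i] u[of j] by linarith
  qed
  have "L2_Cauchy N u"
    unfolding L2_Cauchy_def
  proof (intro allI impI)
    fix e :: real assume "e > 0"
    then obtain M where M: "1 / real (Suc M) < e / 4"
      using reals_Archimedean[of "e / 4"] by (auto simp: inverse_eq_divide)
    have *: "1 / real (Suc i) < e / 4" if "i \<ge> M" for i
      using M that by (intro le_less_trans[OF _ M]) (simp add: field_simps)
    show "\<exists>M. \<forall>i\<ge>M. \<forall>j\<ge>M. L2_sqnorm N (\<lambda>x. u i x - u j x) < e"
    proof (intro exI allI impI)
      fix i j assume "M \<le> i" "M \<le> j"
      then show "L2_sqnorm N (\<lambda>x. u i x - u j x) < e"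
        using parallelogram[of i j] *[of i] *[of j] by simp
    qed
  qed
  with complete uV obtain r v where r: "strict_mono r" and vV: "v \<in> V" and lim: "L2_lim N (\<lambda>n. u (r n)) v"
    by blast
  have vsq: "square_integrable N v" by (rule V[OF vV])
  have "L2_lim N (\<lambda>n x. f x - u (r n) x) (\<lambda>x. f x - v x)"
    using lim unfolding L2_lim_def by (simp add: norm_minus_commute)
  then have lim': "(\<lambda>n. J (u (r n))) \<longlonglongrightarrow> J v"
    unfolding J_def by (intro L2_lim_sqnorm square_integrable_diff f usq vsq)
  have "(\<lambda>n. d + 1 / real (Suc n)) \<longlonglongrightarrow> d + 0"
    by (intro tendsto_intros LIMSEQ_Suc lim_1_over_n)
  then have "(\<lambda>n. d + 1 / real (Suc (r n))) \<longlonglongrightarrow> d"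
    using LIMSEQ_subseq_LIMSEQ[OF _ r] by (fastforce simp: o_def)
  then have "J v \<le> d"
    using lim' u by (intro LIMSEQ_le) (auto intro!: exI[of _ 0] less_imp_le)
  then have Jv: "J v = d" using d_le[OF vV] by simp
  have "L2_inner N (\<lambda>x. f x - v x) e = 0" if eV: "e \<in> V" for e
  proof (rule ccontr)
    define s where "s = L2_inner N (\<lambda>x. f x - v x) e"
    define t where "t = L2_sqnorm N e"
    assume "L2_inner N (\<lambda>x. f x - v x) e \<noteq> 0"
    then have s: "s \<noteq> 0" by (simp add: s_def)
    have esq: "square_integrable N e" and fvsq: "square_integrable N (\<lambda>x. f x - v x)"
      using V eV f vsq by (auto intro: square_integrable_diff)
    have "(cmod s)\<^sup>2 \<le> J v * t"
      unfolding s_def t_def J_def by (rule L2_Cauchy_Schwarz[OF fvsq esq])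
    with s have "t \<noteq> 0" by auto
    then have t: "t > 0" using L2_sqnorm_nonneg[of N e] unfolding t_def by linarith
    \<comment> \<open>\<open>c * e\<close> is the projection of the residual onto \<open>e\<close>; subtracting it lowers the squared distance by \<open>|s|\<^sup>2 / t\<close>\<close>
    define c where "c = s / complex_of_real t"
    have "(\<lambda>x. v x + c * e x) \<in> V" by (intro add scale vV eV)
    then have "d \<le> J (\<lambda>x. v x + c * e x)" by (rule d_le)
    also have "J (\<lambda>x. v x + c * e x) = L2_sqnorm N (\<lambda>x. (f x - v x) - c * e x)"
      by (simp add: J_def algebra_simps)
    also have "\<dots> = J v + (cmod c)\<^sup>2 * t - 2 * Re (cnj c * s)"
      by (simp add: L2_sqnorm_diff[OF fvsq square_integrable_cmult[OF esq]] L2_sqnorm_cmult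
          L2_inner_cmult_right J_def s_def t_def)
    also have "cnj c * s = complex_of_real ((cmod s)\<^sup>2 / t)"
      by (simp add: c_def complex_norm_square mult.commute del: of_real_power)
    also have "(cmod c)\<^sup>2 * t = (cmod s)\<^sup>2 / t"
      using t by (simp add: c_def norm_divide power_divide power2_eq_square)
    finally have "(cmod s)\<^sup>2 / t \<le> 0" using Jv by simp
    then show False using s t by (simp add: divide_le_0_iff)
  qed
  with vV show thesis by (rule that)
qed

section \<open>Bounded continuous integrable functions\<close>

text \<open>
  The class of test functions. It is large enough to be dense in \<open>L\<^sup>2(\<real>)\<close> and stable under convolution
  with integrable functions, and small enough that Plancherel's identity follows from pointwise
  convergence of Gaussian mollifications.
\<close>

definition bounded_continuous_L1 :: "(real \<Rightarrow> complex) \<Rightarrow> bool" where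
  "bounded_continuous_L1 h \<longleftrightarrow> continuous_on UNIV h \<and> bounded (range h) \<and> integrable lborel h"

lemma bounded_continuous_L1_measurable [measurable_dest]:
  "bounded_continuous_L1 h \<Longrightarrow> h \<in> borel_measurable borel"
  by (simp add: bounded_continuous_L1_def borel_measurable_continuous_onI)

lemma bounded_continuous_L1_bound:
  assumes "bounded_continuous_L1 h"
  obtains K where "K > 0" "\<And>x. cmod (h x) \<le> K"
  using assms unfolding bounded_continuous_L1_def bounded_pos by auto

lemma bounded_continuous_L1_square_integrable:
  assumes h: "bounded_continuous_L1 h"
  shows "square_integrable lborel h"
proof -
  obtain K where K: "K > 0" "\<And>x. cmod (h x) \<le> K" using bounded_continuous_L1_bound[OF h] by metis
  have [measurable]: "h \<in> borel_measurable borel" using h by measurable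
  have "integrable lborel (\<lambda>x. (cmod (h x))\<^sup>2)"
  proof (rule Bochner_Integration.integrable_bound)
    show "integrable lborel (\<lambda>x. K * cmod (h x))"
      using h by (auto simp: bounded_continuous_L1_def)
    show "AE x in lborel. norm ((cmod (h x))\<^sup>2) \<le> norm (K * cmod (h x))"
      using K by (auto simp: power2_eq_square intro!: mult_right_mono)
  qed measurable
  then show ?thesis by (simp add: square_integrable_def)
qed

lemma bounded_continuous_L1_diff:
  assumes "bounded_continuous_L1 h" "bounded_continuous_L1 k"
  shows "bounded_continuous_L1 (\<lambda>x. h x - k x)"
  using assms unfolding bounded_continuous_L1_def
  by (auto intro!: continuous_intros bounded_minus_comp)

lemma bounded_continuous_L1_unimodular_mult:
  assumes "bounded_continuous_L1 h" and e: "continuous_on UNIV e" "\<And>x. cmod (e x) = 1"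
  shows "bounded_continuous_L1 (\<lambda>x. e x * h x)"
proof -
  have [measurable]: "e \<in> borel_measurable borel" "h \<in> borel_measurable borel"
    using assms by (auto simp: bounded_continuous_L1_def intro: borel_measurable_continuous_onI)
  have "integrable lborel (\<lambda>x. e x * h x)"
    by (rule Bochner_Integration.integrable_bound[of _ h])
      (use assms in \<open>auto simp: bounded_continuous_L1_def norm_mult\<close>)
  then show ?thesis
    using assms unfolding bounded_continuous_L1_def bounded_iff
    by (auto simp: norm_mult intro!: continuous_intros)
qed

text \<open>
  First \<open>g\<close> is truncated in domain and in range. A measurable function is an almost everywhere limit of
  continuous functions; clipping these to the bound of the truncation and multiplying them by a
  continuous cutoff gives dominated convergence in \<open>L\<^sup>2\<close>.
\<close>

lemma bounded_continuous_L1_dense: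
  assumes g: "square_integrable lborel g"
  obtains h where "\<And>n. bounded_continuous_L1 (h n)" "L2_lim lborel h g"
proof -
  have [measurable]: "g \<in> borel_measurable borel" using g by (auto simp: square_integrable_def)
  define trunc where "trunc n x = (if cmod (g x) \<le> real (Suc n) \<and> \<bar>x\<bar> \<le> real (Suc n) then g x else 0)" for n x
  have [measurable]: "trunc n \<in> borel_measurable borel" for n
    unfolding trunc_def[abs_def] by measurable
  have trunc_lim: "L2_lim lborel trunc g"
  proof (rule L2_lim_dominated[where w="\<lambda>x. cmod (g x)"])
    show "AE x in lborel. (\<lambda>n. trunc n x) \<longlonglongrightarrow> g x"
    proof (rule AE_I2, rule tendsto_eventually)
      fix x
      obtain m where m: "max (cmod (g x)) \<bar>x\<bar> \<le> real m" using real_arch_simple by blast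
      show "\<forall>\<^sub>F n in sequentially. trunc n x = g x"
      proof (rule eventually_sequentiallyI)
        fix n assume "m \<le> n"
        then have "max (cmod (g x)) \<bar>x\<bar> \<le> real (Suc n)" using m by linarith
        then show "trunc n x = g x" by (simp add: trunc_def)
      qed
    qed
  qed (use g in \<open>auto simp: trunc_def square_integrable_def\<close>)
  have step: "\<exists>h. bounded_continuous_L1 h \<and> L2_energy lborel (\<lambda>x. h x - trunc n x) < ennreal (1 / real (Suc n))" for n
  proof -
    define M where "M = real (Suc n)"
    have M: "M > 0" by (simp add: M_def)
    \<comment> \<open>radial retraction of the plane onto the disc of radius \<open>M\<close>\<close>
    define clip :: "complex \<Rightarrow> complex" where "clip z = z / of_real (max 1 (cmod z / M))" for z
    have clip_le: "cmod (clip z) \<le> M" for z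
      using M by (simp add: clip_def norm_divide field_simps max_def)
    have clip_id: "clip z = z" if "cmod z \<le> M" for z
      using that M by (simp add: clip_def max_def)
    have clip_cont: "continuous_on UNIV clip"
      unfolding clip_def[abs_def] using M by (intro continuous_intros) auto
    define cut :: "real \<Rightarrow> real" where "cut x = max 0 (min 1 (M + 1 - \<bar>x\<bar>))" for x
    have cut_cont: "continuous_on UNIV cut" unfolding cut_def[abs_def] by (intro continuous_intros)
    have cut_le: "\<bar>cut x\<bar> \<le> indicator {-(M+1)..M+1} x" for x
      by (auto simp: cut_def indicator_def max_def min_def)
    have cut_1: "cut x = 1" if "\<bar>x\<bar> \<le> M" for x using that by (simp add: cut_def)
    have "trunc n measurable_on UNIV"
      by (rule lebesgue_measurable_imp_measurable_on) (auto intro: measurable_completion)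
    then obtain Z c where Z: "negligible Z" and c: "\<And>k. continuous_on UNIV (c k)"
      and c_lim: "\<And>x. x \<notin> Z \<Longrightarrow> (\<lambda>k. c k x) \<longlonglongrightarrow> trunc n x"
      unfolding measurable_on_def by auto
    have box: "integrable lborel (indicat_real {-(M+1)..M+1})"
      by (rule integrable_real_indicator) (auto simp: emeasure_lborel_Icc_eq)
    define h where "h k x = complex_of_real (cut x) * clip (c k x)" for k x
    have h_cont: "continuous_on UNIV (h k)" for k
      unfolding h_def[abs_def] using cut_cont c[of k]
      by (intro continuous_intros continuous_on_compose2[OF clip_cont]) auto
    then have [measurable]: "h k \<in> borel_measurable borel" for k
      by (rule borel_measurable_continuous_onI)
    have h_le: "cmod (h k x) \<le> M * indicator {-(M+1)..M+1} x" for k x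
      unfolding h_def norm_mult norm_of_real
      using mult_mono[OF cut_le clip_le] by (simp add: mult.commute)
    have h: "bounded_continuous_L1 (h k)" for k
      unfolding bounded_continuous_L1_def
    proof (intro conjI h_cont)
      have "cmod (h k x) \<le> M" for x
        using h_le[of k x] M by (cases "x \<in> {-(M+1)..M+1}") auto
      then show "bounded (range (h k))" by (auto simp: bounded_iff)
      show "integrable lborel (h k)"
        by (rule Bochner_Integration.integrable_bound[where f="\<lambda>x. M * indicator {-(M+1)..M+1} x"])
           (use h_le M box in \<open>auto simp: abs_mult\<close>)
    qed
    have "L2_lim lborel h (trunc n)"
    proof (rule L2_lim_dominated[where w="\<lambda>x. M * indicator {-(M+1)..M+1} x"])
      have "integrable lborel (\<lambda>x. M\<^sup>2 * indicator {-(M+1)..M+1} x)"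
        by (rule integrable_mult_right[OF box])
      then show "integrable lborel (\<lambda>x. (M * indicator {-(M+1)..M+1} x)\<^sup>2)"
        by (rule Bochner_Integration.integrable_cong[THEN iffD1, rotated -1])
           (auto simp: indicator_def)
      have "AE x in lebesgue. x \<notin> Z" using Z by (simp add: negligible_iff_null_sets AE_not_in)
      then have "AE x in lborel. x \<notin> Z" by (simp add: AE_completion_iff)
      then show "AE x in lborel. (\<lambda>k. h k x) \<longlonglongrightarrow> trunc n x"
      proof eventually_elim
        fix x assume "x \<notin> Z"
        then have "(\<lambda>k. clip (c k x)) \<longlonglongrightarrow> clip (trunc n x)"
          by (intro continuous_on_tendsto_compose[OF clip_cont c_lim]) auto
        then have "(\<lambda>k. h k x) \<longlonglongrightarrow> cut x * clip (trunc n x)"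
          unfolding h_def by (intro tendsto_intros)
        moreover have "cut x * clip (trunc n x) = trunc n x"
        proof (cases "trunc n x = 0")
          case True
          then show ?thesis by (simp add: clip_def)
        next
          case False
          then have "cmod (trunc n x) \<le> M" "\<bar>x\<bar> \<le> M"
            unfolding trunc_def M_def by (auto split: if_splits)
          then show ?thesis by (simp add: clip_id cut_1)
        qed
        ultimately show "(\<lambda>k. h k x) \<longlonglongrightarrow> trunc n x" by simp
      qed
    qed (use h_le in auto)
    then have "\<forall>\<^sub>F k in sequentially. L2_energy lborel (\<lambda>x. h k x - trunc n x) < ennreal (1 / real (Suc n))"
      unfolding L2_lim_energy by (rule order_tendstoD) simp
    then show ?thesis
      using h by (auto simp: eventually_sequentially)
  qed
  then obtain h where h: "\<And>n. bounded_continuous_L1 (h n)"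
    and h_trunc: "\<And>n. L2_energy lborel (\<lambda>x. h n x - trunc n x) < ennreal (1 / real (Suc n))" by metis
  have [measurable]: "h n \<in> borel_measurable borel" for n using h[of n] by measurable
  have "(\<lambda>n. L2_energy lborel (\<lambda>x. h n x - g x)) \<longlonglongrightarrow> 0"
  proof (rule tendsto_sandwich[OF _ _ tendsto_const])
    show "\<forall>\<^sub>F n in sequentially. L2_energy lborel (\<lambda>x. h n x - g x)
        \<le> 2 * ennreal (1 / real (Suc n)) + 2 * L2_energy lborel (\<lambda>x. trunc n x - g x)"
    proof (rule always_eventually, rule allI)
      fix n
      have "L2_energy lborel (\<lambda>x. h n x - g x) = L2_energy lborel (\<lambda>x. (h n x - trunc n x) + (trunc n x - g x))"
        by simp
      also have "\<dots> \<le> 2 * L2_energy lborel (\<lambda>x. h n x - trunc n x) + 2 * L2_energy lborel (\<lambda>x. trunc n x - g x)"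
        by (rule energy_add_le) measurable
      also have "\<dots> \<le> 2 * ennreal (1 / real (Suc n)) + 2 * L2_energy lborel (\<lambda>x. trunc n x - g x)"
        using less_imp_le[OF h_trunc[of n]] by (intro add_right_mono mult_left_mono) auto
      finally show "L2_energy lborel (\<lambda>x. h n x - g x)
        \<le> 2 * ennreal (1 / real (Suc n)) + 2 * L2_energy lborel (\<lambda>x. trunc n x - g x)" .
    qed
    have "(\<lambda>n. ennreal (1 / real (Suc n))) \<longlonglongrightarrow> ennreal 0"
      by (intro tendsto_ennrealI LIMSEQ_Suc lim_1_over_n)
    then have "(\<lambda>n. 2 * ennreal (1 / real (Suc n)) + 2 * L2_energy lborel (\<lambda>x. trunc n x - g x)) \<longlonglongrightarrow> 2 * ennreal 0 + 2 * 0"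
      using trunc_lim unfolding L2_lim_energy by (intro tendsto_add ennreal_tendsto_cmult) auto
    then show "(\<lambda>n. 2 * ennreal (1 / real (Suc n)) + 2 * L2_energy lborel (\<lambda>x. trunc n x - g x)) \<longlonglongrightarrow> 0"
      by simp
  qed auto
  then have "L2_lim lborel h g" by (simp add: L2_lim_energy)
  with h show thesis by (rule that)
qed


section \<open>The Fourier transform and Plancherel's identity\<close>

definition fourier :: "(real \<Rightarrow> complex) \<Rightarrow> real \<Rightarrow> complex" where
  "fourier f \<xi> = (\<integral>t. f t * cis (- (\<xi> * t)) \<partial>lborel)"

lemma integrable_mult_bounded:
  fixes f m :: "real \<Rightarrow> complex"
  assumes "integrable lborel f" and [measurable]: "m \<in> borel_measurable borel"
    and "\<And>x. cmod (m x) \<le> K"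
  shows "integrable lborel (\<lambda>x. f x * m x)"
proof (rule Bochner_Integration.integrable_bound)
  show "integrable lborel (\<lambda>x. K * cmod (f x))" using assms by simp
  have "0 \<le> K" using norm_ge_zero assms(3) order_trans by blast
  then show "AE x in lborel. norm (f x * m x) \<le> norm (K * cmod (f x))"
    using mult_right_mono[OF assms(3) norm_ge_zero] by (intro AE_I2) (simp add: norm_mult mult.commute[of "cmod (f _)"] abs_mult)
qed (use assms in measurable)

lemma measurable_fourier [measurable]:
  assumes [measurable]: "f \<in> borel_measurable borel"
  shows "fourier f \<in> borel_measurable borel"
  unfolding fourier_def[abs_def] by measurable

lemma fourier_bound: "cmod (fourier f \<xi>) \<le> (\<integral>t. cmod (f t) \<partial>lborel)"
  unfolding fourier_def by (rule order_trans[OF integral_norm_bound]) (simp add: norm_mult)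

text \<open>
  The exchange of integrals behind both uses of the Fourier kernel: a bounded kernel may be moved
  from one integrable function to another.
\<close>

lemma Fubini_bounded_kernel:
  fixes f g :: "real \<Rightarrow> complex"
  assumes f: "integrable lborel f" and g: "integrable lborel g"
    and m: "(\<lambda>(x, y). m x y) \<in> borel_measurable (lborel \<Otimes>\<^sub>M lborel)"
    and K: "\<And>x y. cmod (m x y) \<le> K"
  shows "(\<integral>x. f x * (\<integral>y. g y * m x y \<partial>lborel) \<partial>lborel) = (\<integral>y. g y * (\<integral>x. f x * m x y \<partial>lborel) \<partial>lborel)"
proof -
  note [measurable] = borel_measurable_integrable[OF f] borel_measurable_integrable[OF g]
  have [measurable (raw)]: "(\<lambda>x. m (u x) (v x)) \<in> borel_measurable N"
    if "u \<in> borel_measurable N" "v \<in> borel_measurable N" for u v and N :: "'z measure"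
  proof -
    have "(\<lambda>x. (u x, v x)) \<in> N \<rightarrow>\<^sub>M lborel \<Otimes>\<^sub>M lborel"
      using that by (intro measurable_Pair) auto
    from measurable_compose[OF this m] show ?thesis by simp
  qed
  have K0: "0 \<le> K" using norm_ge_zero K order_trans by blast
  have "integrable (lborel \<Otimes>\<^sub>M lborel) (\<lambda>(x, y). f x * (g y * m x y))"
  proof (rule Bochner_Integration.integrable_bound)
    show "integrable (lborel \<Otimes>\<^sub>M lborel) (\<lambda>(x, y). K * (f x * g y))"
    proof (rule lborel_pair.Fubini_integrable)
      show "integrable lborel (\<lambda>x. \<integral>y. norm (case (x, y) of (x, y) \<Rightarrow> complex_of_real K * (f x * g y)) \<partial>lborel)"
        using f g by (simp add: norm_mult)
      show "AE x in lborel. integrable lborel (\<lambda>y. case (x, y) of (x, y) \<Rightarrow> complex_of_real K * (f x * g y))"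
        using g by simp
    qed measurable
    show "(\<lambda>(x, y). f x * (g y * m x y)) \<in> borel_measurable (lborel \<Otimes>\<^sub>M lborel)"
      using m by measurable
    have "cmod (f x * (g y * m x y)) \<le> cmod (of_real K * (f x * g y))" for x y
      using mult_left_mono[OF K[of x y], of "cmod (f x) * cmod (g y)"] K0
      by (simp add: norm_mult mult_ac)
    then show "AE x in lborel \<Otimes>\<^sub>M lborel. norm (case x of (x, y) \<Rightarrow> f x * (g y * m x y))
        \<le> norm (case x of (x, y) \<Rightarrow> complex_of_real K * (f x * g y))"
      by (intro AE_I2) (simp split: prod.split)
  qed
  from lborel_pair.Fubini_integral[OF this]
  have "(\<integral>y. (\<integral>x. f x * (g y * m x y) \<partial>lborel) \<partial>lborel) = (\<integral>x. (\<integral>y. f x * (g y * m x y) \<partial>lborel) \<partial>lborel)" .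
  moreover have "(\<integral>x. f x * (g y * m x y) \<partial>lborel) = g y * (\<integral>x. f x * m x y \<partial>lborel)" for y
    unfolding mult.left_commute[of "f _" "g y"] by simp
  ultimately show ?thesis by simp
qed

lemma fourier_std_normal:
  "(\<integral>y. complex_of_real (std_normal_density y) * cis (y * z) \<partial>lborel) = exp (- (z\<^sup>2) / 2)"
proof -
  have "char std_normal_distribution z = (\<integral>y. std_normal_density y *\<^sub>R iexp (z * y) \<partial>lborel)"
    unfolding char_def by (subst integral_density) auto
  also have "\<dots> = (\<integral>y. complex_of_real (std_normal_density y) * cis (y * z) \<partial>lborel)"
    by (simp add: scaleR_conv_of_real cis_conv_exp mult_ac)
  finally show ?thesis by (simp add: char_std_normal_distribution)
qed

text \<open>
  Fourier inversion with a Gaussian convergence factor. Up to normalisation the Gaussian is its own Fourier transform, so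
  multiplying the transform of \<open>F\<close> by a wide Gaussian and inverting averages \<open>F\<close> against a narrow one.
\<close>

lemma fourier_gaussian_inversion:
  fixes F :: "real \<Rightarrow> complex"
  assumes F: "integrable lborel F" and \<epsilon>: "\<epsilon> > 0"
  shows "(\<integral>\<xi>. fourier F \<xi> * complex_of_real (exp (- ((\<epsilon> * \<xi>)\<^sup>2) / 2)) * cis (\<xi> * t) \<partial>lborel)
    = 2 * pi * (\<integral>x. F (t + \<epsilon> * x) * std_normal_density x \<partial>lborel)"
proof -
  note [measurable] = borel_measurable_integrable[OF F]
  define \<gamma> :: "real \<Rightarrow> complex" where "\<gamma> y = complex_of_real (exp (- (y\<^sup>2) / 2))" for y
  have \<gamma>_dens: "\<gamma> y = complex_of_real (sqrt (2 * pi)) * complex_of_real (std_normal_density y)" for y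
    by (simp add: \<gamma>_def std_normal_density_def)
  have "integrable lborel (\<lambda>y. complex_of_real (std_normal_density y))"
    by (simp add: integrable_normal_density)
  then have \<gamma>_int: "integrable lborel \<gamma>" unfolding \<gamma>_dens[abs_def] by simp
  then have g: "integrable lborel (\<lambda>\<xi>. \<gamma> (\<epsilon> * \<xi>))"
    using lborel_integrable_real_affine[of \<gamma> \<epsilon> 0] \<epsilon> by simp
  have \<gamma>_hat: "(\<integral>\<xi>. \<gamma> (\<epsilon> * \<xi>) * cis (\<xi> * (t - s)) \<partial>lborel) = sqrt (2 * pi) / \<epsilon> * \<gamma> ((s - t) / \<epsilon>)" for s
  proof -
    have "(\<integral>y. \<gamma> y * cis (y * ((t - s) / \<epsilon>)) \<partial>lborel)
        = sqrt (2 * pi) * (\<integral>y. complex_of_real (std_normal_density y) * cis (y * ((t - s) / \<epsilon>)) \<partial>lborel)"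
      unfolding \<gamma>_dens by (simp add: mult.assoc)
    also have "\<dots> = sqrt (2 * pi) * \<gamma> ((s - t) / \<epsilon>)"
      unfolding fourier_std_normal \<gamma>_def by (simp add: power_divide power2_commute)
    finally have "(\<integral>y. \<gamma> y * cis (y * ((t - s) / \<epsilon>)) \<partial>lborel) = sqrt (2 * pi) * \<gamma> ((s - t) / \<epsilon>)" .
    also have "(\<integral>y. \<gamma> y * cis (y * ((t - s) / \<epsilon>)) \<partial>lborel)
        = \<epsilon> *\<^sub>R (\<integral>\<xi>. \<gamma> (\<epsilon> * \<xi>) * cis (\<xi> * (t - s)) \<partial>lborel)"
      using \<epsilon> by (subst lborel_integral_real_affine[of \<epsilon> _ 0]) auto
    finally show ?thesis using \<epsilon> by (simp add: scaleR_conv_of_real field_simps)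
  qed
  have "(\<integral>\<xi>. fourier F \<xi> * complex_of_real (exp (- ((\<epsilon> * \<xi>)\<^sup>2) / 2)) * cis (\<xi> * t) \<partial>lborel)
      = (\<integral>\<xi>. \<gamma> (\<epsilon> * \<xi>) * (\<integral>s. F s * cis (\<xi> * (t - s)) \<partial>lborel) \<partial>lborel)"
  proof (intro Bochner_Integration.integral_cong refl)
    fix \<xi>
    have "F s * cis (\<xi> * (t - s)) = F s * cis (- (\<xi> * s)) * cis (\<xi> * t)" for s
      by (simp add: cis_mult mult.assoc algebra_simps)
    then have "(\<integral>s. F s * cis (\<xi> * (t - s)) \<partial>lborel) = (\<integral>s. F s * cis (- (\<xi> * s)) * cis (\<xi> * t) \<partial>lborel)"
      by (simp only:)
    then have "(\<integral>s. F s * cis (\<xi> * (t - s)) \<partial>lborel) = fourier F \<xi> * cis (\<xi> * t)"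
      unfolding fourier_def by simp
    then show "fourier F \<xi> * complex_of_real (exp (- ((\<epsilon> * \<xi>)\<^sup>2) / 2)) * cis (\<xi> * t)
        = \<gamma> (\<epsilon> * \<xi>) * (\<integral>s. F s * cis (\<xi> * (t - s)) \<partial>lborel)"
      by (simp add: \<gamma>_def mult_ac)
  qed
  also have "\<dots> = (\<integral>s. F s * (\<integral>\<xi>. \<gamma> (\<epsilon> * \<xi>) * cis (\<xi> * (t - s)) \<partial>lborel) \<partial>lborel)"
    by (rule Fubini_bounded_kernel[OF g F, where K=1]) auto
  also have "\<dots> = sqrt (2 * pi) / \<epsilon> * (\<integral>s. F s * \<gamma> ((s - t) / \<epsilon>) \<partial>lborel)"
    unfolding \<gamma>_hat mult.left_commute[of "F _" "complex_of_real _"] by (rule integral_mult_right_zero)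
  also have "(\<integral>s. F s * \<gamma> ((s - t) / \<epsilon>) \<partial>lborel) = \<epsilon> *\<^sub>R (\<integral>x. F (t + \<epsilon> * x) * \<gamma> x \<partial>lborel)"
    using \<epsilon> by (subst lborel_integral_real_affine[of \<epsilon> _ t]) auto
  also have "(\<integral>x. F (t + \<epsilon> * x) * \<gamma> x \<partial>lborel) = sqrt (2 * pi) * (\<integral>x. F (t + \<epsilon> * x) * std_normal_density x \<partial>lborel)"
    unfolding \<gamma>_dens mult.left_commute[of "F _" "complex_of_real (sqrt (2 * pi))"]
    by (rule integral_mult_right_zero)
  finally show ?thesis
    using \<epsilon> by (simp add: scaleR_conv_of_real field_simps flip: of_real_mult)
qed

text \<open>
  Pairing the regularised inversion formula with the conjugate of \<open>F\<close> gives
  \<open>\<integral> |fourier F|\<^sup>2 exp(-(\<epsilon> \<xi>)\<^sup>2 / 2) d\<xi> = 2 \<pi> \<langle>F\<^sub>\<epsilon>, F\<rangle>\<close>, with \<open>F\<^sub>\<epsilon>\<close> the Gaussian average of \<open>F\<close> at scale \<open>\<epsilon>\<close>.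
  As \<open>\<epsilon>\<close> tends to \<open>0\<close>, the left side increases to the energy of the transform, and on the right
  \<open>F\<^sub>\<epsilon>\<close> converges pointwise to \<open>F\<close> by continuity and remains bounded by the bound of \<open>F\<close>.
\<close>

lemma Plancherel_bounded_continuous_L1:
  assumes F: "bounded_continuous_L1 F"
  shows "L2_energy lborel (fourier F) = ennreal (2 * pi) * L2_energy lborel F"
proof -
  have F_int: "integrable lborel F" and F_cont: "continuous_on UNIV F"
    using F by (auto simp: bounded_continuous_L1_def)
  have F_sq: "square_integrable lborel F" by (rule bounded_continuous_L1_square_integrable[OF F])
  note [measurable] = borel_measurable_integrable[OF F_int]
  obtain K where K: "K > 0" "\<And>x. cmod (F x) \<le> K" using bounded_continuous_L1_bound[OF F] by metis
  define \<epsilon> where "\<epsilon> n = 1 / real (Suc n)" for n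
  have \<epsilon>: "\<epsilon> n > 0" for n by (simp add: \<epsilon>_def)
  have \<epsilon>0: "\<epsilon> \<longlonglongrightarrow> 0" unfolding \<epsilon>_def[abs_def] by (intro LIMSEQ_Suc lim_1_over_n)
  define \<gamma> :: "nat \<Rightarrow> real \<Rightarrow> real" where "\<gamma> n \<xi> = exp (- ((\<epsilon> n * \<xi>)\<^sup>2) / 2)" for n \<xi>
  have [measurable]: "\<gamma> n \<in> borel_measurable borel" for n unfolding \<gamma>_def[abs_def] by measurable
  have \<gamma>_int: "integrable lborel (\<gamma> n)" for n
  proof -
    have "integrable lborel (\<lambda>x. sqrt (2 * pi) * std_normal_density (0 + \<epsilon> n * x))"
      using \<epsilon>[of n] by (intro integrable_mult_right lborel_integrable_real_affine)
        (auto simp: integrable_normal_density)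
    then show ?thesis by (simp add: \<gamma>_def[abs_def] std_normal_density_def)
  qed
  define mol where "mol n t = (\<integral>x. F (t + \<epsilon> n * x) * std_normal_density x \<partial>lborel)" for n t
  have mol_lim: "(\<lambda>n. mol n t) \<longlonglongrightarrow> F t" for t
  proof -
    have "(\<lambda>n. mol n t) \<longlonglongrightarrow> (\<integral>x. F t * std_normal_density x \<partial>lborel)"
      unfolding mol_def
    proof (rule integral_dominated_convergence[where w="\<lambda>x. K * std_normal_density x"])
      show "AE x in lborel. (\<lambda>n. F (t + \<epsilon> n * x) * std_normal_density x) \<longlonglongrightarrow> F t * std_normal_density x"
      proof (rule AE_I2)
        fix x
        have "(\<lambda>n. t + \<epsilon> n * x) \<longlonglongrightarrow> t + 0 * x" by (intro tendsto_intros \<epsilon>0)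
        then have "(\<lambda>n. F (t + \<epsilon> n * x)) \<longlonglongrightarrow> F t"
          by (intro continuous_on_tendsto_compose[OF F_cont]) auto
        then show "(\<lambda>n. F (t + \<epsilon> n * x) * std_normal_density x) \<longlonglongrightarrow> F t * std_normal_density x"
          by (intro tendsto_intros)
      qed
    qed (use K in \<open>auto simp: integrable_normal_density norm_mult intro!: mult_right_mono\<close>)
    then show ?thesis by (simp add: integral_normal_density)
  qed
  have mol_bound: "cmod (mol n t) \<le> K" for n t
  proof -
    have "cmod (mol n t) \<le> (\<integral>x. K * std_normal_density x \<partial>lborel)"
      unfolding mol_def
    proof (rule Bochner_Integration.integral_norm_bound_integral)
      show "integrable lborel (\<lambda>x. F (t + \<epsilon> n * x) * complex_of_real (std_normal_density x))"
        by (rule Bochner_Integration.integrable_bound[where f="\<lambda>x. K * std_normal_density x"])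
          (use K in \<open>auto simp: integrable_normal_density norm_mult intro!: mult_right_mono\<close>)
    qed (use K in \<open>auto simp: integrable_normal_density norm_mult intro!: mult_right_mono\<close>)
    then show ?thesis by (simp add: integral_normal_density)
  qed
  have mol_meas [measurable]: "mol n \<in> borel_measurable borel" for n
    unfolding mol_def[abs_def] by measurable
  have regularised: "(\<integral>\<^sup>+\<xi>. ennreal ((cmod (fourier F \<xi>))\<^sup>2 * \<gamma> n \<xi>) \<partial>lborel)
      = ennreal (2 * pi * Re (\<integral>t. cnj (F t) * mol n t \<partial>lborel))" for n
  proof -
    have g: "integrable lborel (\<lambda>\<xi>. fourier F \<xi> * \<gamma> n \<xi>)"
      using integrable_mult_bounded[of "\<lambda>\<xi>. complex_of_real (\<gamma> n \<xi>)" "fourier F", OF _ _ fourier_bound] \<gamma>_int[of n]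
      by (simp add: mult.commute)
    have "(\<integral>t. cnj (F t) * (\<integral>\<xi>. fourier F \<xi> * \<gamma> n \<xi> * cis (\<xi> * t) \<partial>lborel) \<partial>lborel)
        = (\<integral>\<xi>. fourier F \<xi> * \<gamma> n \<xi> * (\<integral>t. cnj (F t) * cis (\<xi> * t) \<partial>lborel) \<partial>lborel)"
      by (rule Fubini_bounded_kernel[OF _ g, where K=1]) (use F_int in auto)
    also have "\<dots> = (\<integral>\<xi>. complex_of_real ((cmod (fourier F \<xi>))\<^sup>2 * \<gamma> n \<xi>) \<partial>lborel)"
    proof (intro Bochner_Integration.integral_cong refl)
      fix \<xi>
      have "(\<integral>t. cnj (F t) * cis (\<xi> * t) \<partial>lborel) = cnj (fourier F \<xi>)"
        unfolding fourier_def Bochner_Integration.integral_cnj[symmetric] by (simp add: cis_cnj)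
      then show "fourier F \<xi> * \<gamma> n \<xi> * (\<integral>t. cnj (F t) * cis (\<xi> * t) \<partial>lborel)
          = complex_of_real ((cmod (fourier F \<xi>))\<^sup>2 * \<gamma> n \<xi>)"
        by (simp add: complex_norm_square mult_ac del: of_real_power)
    qed
    also have "\<dots> = of_real (\<integral>\<xi>. (cmod (fourier F \<xi>))\<^sup>2 * \<gamma> n \<xi> \<partial>lborel)"
      by (rule integral_complex_of_real)
    also have "(\<integral>t. cnj (F t) * (\<integral>\<xi>. fourier F \<xi> * \<gamma> n \<xi> * cis (\<xi> * t) \<partial>lborel) \<partial>lborel)
        = 2 * pi * (\<integral>t. cnj (F t) * mol n t \<partial>lborel)"
      using fourier_gaussian_inversion[OF F_int \<epsilon>[of n]]
      by (simp add: \<gamma>_def mol_def mult.left_commute[of "cnj _"])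
    finally have "2 * pi * Re (\<integral>t. cnj (F t) * mol n t \<partial>lborel) = (\<integral>\<xi>. (cmod (fourier F \<xi>))\<^sup>2 * \<gamma> n \<xi> \<partial>lborel)"
      by (auto dest: arg_cong[of _ _ Re])
    moreover have "integrable lborel (\<lambda>\<xi>. (cmod (fourier F \<xi>))\<^sup>2 * \<gamma> n \<xi>)"
    proof (rule Bochner_Integration.integrable_bound)
      show "integrable lborel (\<lambda>\<xi>. (\<integral>t. cmod (F t) \<partial>lborel)\<^sup>2 * \<gamma> n \<xi>)" using \<gamma>_int by simp
      show "AE \<xi> in lborel. norm ((cmod (fourier F \<xi>))\<^sup>2 * \<gamma> n \<xi>) \<le> norm ((\<integral>t. cmod (F t) \<partial>lborel)\<^sup>2 * \<gamma> n \<xi>)"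
        by (auto simp: \<gamma>_def abs_mult intro!: mult_right_mono power_mono fourier_bound)
    qed measurable
    ultimately show ?thesis
      by (subst nn_integral_eq_integral) (auto simp: \<gamma>_def)
  qed
  have "(\<lambda>n. \<integral>\<^sup>+\<xi>. ennreal ((cmod (fourier F \<xi>))\<^sup>2 * \<gamma> n \<xi>) \<partial>lborel) \<longlonglongrightarrow> L2_energy lborel (fourier F)"
    unfolding L2_energy_def
  proof (rule nn_integral_LIMSEQ)
    have "\<epsilon> (Suc n) \<le> \<epsilon> n" for n by (simp add: \<epsilon>_def field_simps)
    then have "(\<epsilon> (Suc n) * \<xi>)\<^sup>2 \<le> (\<epsilon> n * \<xi>)\<^sup>2" for n \<xi>
      unfolding power_mult_distrib using \<epsilon>[of "Suc n"] by (intro mult_right_mono power_mono) auto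
    then show "incseq (\<lambda>n \<xi>. ennreal ((cmod (fourier F \<xi>))\<^sup>2 * \<gamma> n \<xi>))"
      by (intro incseq_SucI le_funI ennreal_leI mult_left_mono) (auto simp: \<gamma>_def)
    fix \<xi>
    have "(\<lambda>n. (cmod (fourier F \<xi>))\<^sup>2 * \<gamma> n \<xi>) \<longlonglongrightarrow> (cmod (fourier F \<xi>))\<^sup>2 * exp (- ((0 * \<xi>)\<^sup>2) / 2)"
      unfolding \<gamma>_def by (intro tendsto_intros \<epsilon>0) auto
    then show "(\<lambda>n. ennreal ((cmod (fourier F \<xi>))\<^sup>2 * \<gamma> n \<xi>)) \<longlonglongrightarrow> ennreal ((cmod (fourier F \<xi>))\<^sup>2)"
      by (intro tendsto_ennrealI) simp
  qed measurable
  moreover have "(\<lambda>n. ennreal (2 * pi * Re (\<integral>t. cnj (F t) * mol n t \<partial>lborel)))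
      \<longlonglongrightarrow> ennreal (2 * pi * Re (\<integral>t. cnj (F t) * F t \<partial>lborel))"
  proof (intro tendsto_intros tendsto_ennrealI
      integral_dominated_convergence[where w="\<lambda>t. K * cmod (F t)"])
    show "AE x in lborel. (\<lambda>n. cnj (F x) * mol n x) \<longlonglongrightarrow> cnj (F x) * F x"
      by (intro AE_I2 tendsto_intros mol_lim)
    show "AE x in lborel. norm (cnj (F x) * mol n x) \<le> K * cmod (F x)" for n
      using mult_right_mono[OF mol_bound norm_ge_zero] by (intro AE_I2) (simp add: norm_mult mult.commute)
  qed (use F_int in auto)
  moreover have "(\<integral>t. cnj (F t) * F t \<partial>lborel) = of_real (L2_sqnorm lborel F)"
    unfolding L2_inner_self[symmetric] L2_inner_def by (simp add: mult.commute)
  ultimately show ?thesis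
    unfolding regularised by (simp add: LIMSEQ_unique energy_eq_sqnorm[OF F_sq] ennreal_mult)
qed

definition convolution :: "(real \<Rightarrow> complex) \<Rightarrow> (real \<Rightarrow> complex) \<Rightarrow> real \<Rightarrow> complex" where
  "convolution h u b = (\<integral>t. h t * u (b - t) \<partial>lborel)"

lemma measurable_convolution [measurable]:
  assumes [measurable]: "h \<in> borel_measurable borel" "u \<in> borel_measurable borel"
  shows "convolution h u \<in> borel_measurable borel"
  unfolding convolution_def[abs_def] by measurable

lemma convolution_commute: "convolution h u b = convolution u h b"
  unfolding convolution_def
  by (subst lborel_integral_real_affine[of "-1" _ b]) (auto simp: mult.commute)

lemma integrable_convolution:
  assumes h: "integrable lborel h" and u: "integrable lborel u"
  shows "integrable lborel (convolution h u)"
proof -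
  note [measurable] = borel_measurable_integrable[OF h] borel_measurable_integrable[OF u]
  have shift: "integrable lborel (\<lambda>b. u (b - t))" for t
    using lborel_integrable_real_affine[OF u, of 1 "-t"] by simp
  have norm_shift: "(\<integral>b. cmod (u (b - t)) \<partial>lborel) = (\<integral>b. cmod (u b) \<partial>lborel)" for t
    by (subst lborel_integral_real_affine[of 1 "\<lambda>b. cmod (u b)" "-t"]) auto
  have "integrable (lborel \<Otimes>\<^sub>M lborel) (\<lambda>(t, b). h t * u (b - t))"
  proof (rule lborel_pair.Fubini_integrable)
    show "integrable lborel (\<lambda>t. \<integral>b. norm (case (t, b) of (t, b) \<Rightarrow> h t * u (b - t)) \<partial>lborel)"
      using h by (simp add: norm_mult norm_shift)
    show "AE t in lborel. integrable lborel (\<lambda>b. case (t, b) of (t, b) \<Rightarrow> h t * u (b - t))"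
      using shift by simp
  qed measurable
  from lborel_pair.integrable_snd[OF this] show ?thesis
    unfolding convolution_def[abs_def] .
qed

lemma fourier_convolution:
  assumes h: "integrable lborel h" and u: "integrable lborel u"
  shows "fourier (convolution h u) \<xi> = fourier h \<xi> * fourier u \<xi>"
proof -
  note [measurable] = borel_measurable_integrable[OF h] borel_measurable_integrable[OF u]
  have shift: "integrable lborel (\<lambda>b. u (b - t))" for t
    using lborel_integrable_real_affine[OF u, of 1 "-t"] by simp
  have norm_shift: "(\<integral>b. cmod (u (b - t)) \<partial>lborel) = (\<integral>b. cmod (u b) \<partial>lborel)" for t
    by (subst lborel_integral_real_affine[of 1 "\<lambda>b. cmod (u b)" "-t"]) auto
  have "integrable (lborel \<Otimes>\<^sub>M lborel) (\<lambda>(t, b). h t * u (b - t) * cis (- (\<xi> * b)))"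
  proof (rule lborel_pair.Fubini_integrable)
    show "integrable lborel (\<lambda>t. \<integral>b. norm (case (t, b) of (t, b) \<Rightarrow> h t * u (b - t) * cis (- (\<xi> * b))) \<partial>lborel)"
      using h by (simp add: norm_mult norm_shift)
    show "AE t in lborel. integrable lborel (\<lambda>b. case (t, b) of (t, b) \<Rightarrow> h t * u (b - t) * cis (- (\<xi> * b)))"
      using shift integrable_mult_bounded[of "\<lambda>b. h _ * u (b - _)" "\<lambda>b. cis (- (\<xi> * b))" 1] by simp
  qed measurable
  from lborel_pair.Fubini_integral[OF this]
  have "fourier (convolution h u) \<xi> = (\<integral>t. h t * (\<integral>b. u (b - t) * cis (- (\<xi> * b)) \<partial>lborel) \<partial>lborel)"
    by (simp only: fourier_def convolution_def integral_mult_left_zero[symmetric])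
       (simp only: mult.assoc integral_mult_right_zero)
  also have "(\<integral>b. u (b - t) * cis (- (\<xi> * b)) \<partial>lborel) = cis (- (\<xi> * t)) * fourier u \<xi>" for t
  proof -
    have "(\<integral>b. u (b - t) * cis (- (\<xi> * b)) \<partial>lborel) = (\<integral>s. u s * cis (- (\<xi> * (t + s))) \<partial>lborel)"
      by (subst lborel_integral_real_affine[of 1 _ t]) auto
    also have "\<dots> = (\<integral>s. cis (- (\<xi> * t)) * (u s * cis (- (\<xi> * s))) \<partial>lborel)"
      by (intro Bochner_Integration.integral_cong refl)
         (simp add: cis_mult mult.left_commute[of "cis _" "u _"] algebra_simps)
    finally show ?thesis by (simp add: fourier_def)
  qed
  then have "(\<integral>t. h t * (\<integral>b. u (b - t) * cis (- (\<xi> * b)) \<partial>lborel) \<partial>lborel) = fourier h \<xi> * fourier u \<xi>"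
    by (simp add: fourier_def mult.assoc[symmetric])
  finally show ?thesis .
qed

lemma bounded_continuous_L1_convolution:
  assumes h: "bounded_continuous_L1 h" and u: "integrable lborel u"
  shows "bounded_continuous_L1 (convolution h u)"
  unfolding bounded_continuous_L1_def
proof (intro conjI)
  have h_int: "integrable lborel h" and h_cont: "continuous_on UNIV h"
    using h by (auto simp: bounded_continuous_L1_def)
  note [measurable] = borel_measurable_integrable[OF h_int] borel_measurable_integrable[OF u]
  obtain K where K: "K > 0" "\<And>x. cmod (h x) \<le> K" using bounded_continuous_L1_bound[OF h] by metis
  have dom: "cmod (u s * h (b - s)) \<le> K * cmod (u s)" for b s
    using mult_right_mono[OF K(2)[of "b - s"], of "cmod (u s)"] by (simp add: norm_mult mult.commute)
  show "integrable lborel (convolution h u)" by (rule integrable_convolution[OF h_int u])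
  show "bounded (range (convolution h u))"
    unfolding bounded_iff
  proof (intro exI ballI, elim rangeE)
    fix z b assume "z = convolution h u b"
    then have "z = (\<integral>s. u s * h (b - s) \<partial>lborel)"
      by (simp add: convolution_commute[of h]) (simp add: convolution_def)
    also have "cmod \<dots> \<le> (\<integral>s. K * cmod (u s) \<partial>lborel)"
      by (rule Bochner_Integration.integral_norm_bound_integral)
        (use u K dom in \<open>auto intro!: integrable_mult_bounded[where K=K]\<close>)
    finally show "cmod z \<le> (\<integral>s. K * cmod (u s) \<partial>lborel)" .
  qed
  show "continuous_on UNIV (convolution h u)"
  proof (clarsimp simp: continuous_on_sequentially convolution_commute[of h])
    fix x :: "nat \<Rightarrow> real" and b assume x: "x \<longlonglongrightarrow> b"
    show "(convolution u h \<circ> x) \<longlonglongrightarrow> convolution u h b"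
      unfolding convolution_def o_def
    proof (rule integral_dominated_convergence[where w="\<lambda>s. K * cmod (u s)"])
      show "AE s in lborel. (\<lambda>i. u s * h (x i - s)) \<longlonglongrightarrow> u s * h (b - s)"
        by (intro AE_I2 tendsto_intros continuous_on_tendsto_compose[OF h_cont] x) auto
    qed (use u dom in auto)
  qed
qed

lemma convolution_energy:
  assumes h: "bounded_continuous_L1 h" and u: "integrable lborel u"
  shows "ennreal (2 * pi) * L2_energy lborel (convolution h u)
    = L2_energy lborel (\<lambda>\<xi>. fourier h \<xi> * fourier u \<xi>)"
  using Plancherel_bounded_continuous_L1[OF bounded_continuous_L1_convolution[OF h u]]
    fourier_convolution[of h u] h u
  by (simp add: bounded_continuous_L1_def L2_energy_def)

section \<open>The wavelet transform at a fixed scale\<close>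

text \<open>
  Convolution with this function is correlation with the dilated wavelet, since its value at \<open>b - t\<close>
  is \<open>cnj (\<psi> ((t - b) / a))\<close>.
\<close>

definition dilate_reflect :: "(real \<Rightarrow> complex) \<Rightarrow> real \<Rightarrow> real \<Rightarrow> complex" where
  "dilate_reflect \<psi> a x = cnj (\<psi> (- (x / a)))"

lemma measurable_dilate_reflect [measurable]:
  assumes [measurable]: "\<psi> \<in> borel_measurable borel"
  shows "dilate_reflect \<psi> a \<in> borel_measurable borel"
  unfolding dilate_reflect_def[abs_def] by measurable

lemma integrable_dilate_reflect:
  assumes \<psi>: "integrable lborel \<psi>" and a: "a > 0"
  shows "integrable lborel (dilate_reflect \<psi> a)"
proof -
  have "integrable lborel (\<lambda>x. \<psi> (0 + (- 1 / a) * x))"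
    using \<psi> a by (intro lborel_integrable_real_affine) auto
  then show ?thesis by (simp add: dilate_reflect_def[abs_def])
qed

text \<open>
  The kernels of the problem are rewritten with \<open>cis\<close>, which makes their moduli and the addition of
  phases accessible to rewriting.
\<close>

declare saft_kernel.simps [simp del] sa_wavelet.simps [simp del] admissibility_fun.simps [simp del]

lemma exp_i_of_real_div:
  "exp (\<i> / of_real (2 * B) * of_real x) = cis (x / (2 * B))"
  by (simp add: cis_conv_exp)

lemma saft_kernel_cis:
  "saft_kernel (A, B, C, D, p, q) t \<omega> = 1 / csqrt (\<i> * of_real (2 * pi * B)) *
     cis ((A * t\<^sup>2 + 2 * t * (p - \<omega>) - 2 * \<omega> * (D * p - B * q) + D * (\<omega>\<^sup>2 + p\<^sup>2)) / (2 * B))"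
  by (simp only: saft_kernel.simps exp_i_of_real_div)

lemma admissibility_fun_cis:
  "admissibility_fun (A, B, C, D, p, q) \<psi> a z = cis ((2 * z * p * (a - 1) - A * z\<^sup>2) / (2 * B)) * cnj (\<psi> (- z))"
  by (simp only: admissibility_fun.simps exp_i_of_real_div)

lemma sa_wavelet_cis:
  "sa_wavelet (A, B, C, D, p, q) \<psi> b a t = 1 / csqrt (\<i> * of_real (2 * pi * a * B)) * \<psi> ((t - b) / a) *
     cis (- ((A * t\<^sup>2 + D * p\<^sup>2 - A * (b / a)\<^sup>2) / (2 * B)))"
proof -
  have "exp (- (\<i> / of_real (2 * B)) * of_real x) = cis (- (x / (2 * B)))" for x
    by (simp add: cis_conv_exp)
  then show ?thesis by (simp only: sa_wavelet.simps)
qed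

lemma measurable_saft [measurable]:
  assumes [measurable]: "f \<in> borel_measurable borel"
  shows "saft M f \<in> borel_measurable borel"
proof -
  obtain A B C D p q where M: "M = (A, B, C, D, p, q)" by (metis surj_pair)
  show ?thesis unfolding M saft_def[abs_def] saft_kernel_cis by measurable
qed

lemma saft_diff:
  assumes f: "integrable lborel f" and g: "integrable lborel g"
  shows "saft M (\<lambda>x. f x - g x) \<omega> = saft M f \<omega> - saft M g \<omega>"
proof -
  obtain A B C D p q where M: "M = (A, B, C, D, p, q)" by (metis surj_pair)
  have "integrable lborel (\<lambda>t. u t * saft_kernel M t \<omega>)" if "integrable lborel u" for u
    unfolding M saft_kernel_cis
    by (rule integrable_mult_bounded[OF that, where K="cmod (1 / csqrt (\<i> * of_real (2 * pi * B)))"])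
       (simp_all add: norm_mult norm_divide)
  then show ?thesis
    unfolding saft_def left_diff_distrib using f g by (intro Bochner_Integration.integral_diff) auto
qed

text \<open>
  This is why the chirp and the modulation in the admissibility condition have the form they have: the
  chirp \<open>-A z\<^sup>2\<close> cancels the chirp of the kernel, and the modulation \<open>2 z p (a - 1)\<close> completes
  \<open>2 z (p - a \<omega>)\<close> to \<open>2 z a (p - \<omega>)\<close>. What remains is an ordinary Fourier transform of the dilated wavelet
  and a phase that does not depend on \<open>z\<close>.
\<close>

lemma saft_admissibility_fun:
  assumes "a > 0" and B: "B \<noteq> 0"
  shows "(cmod (fourier (dilate_reflect \<psi> a) ((\<omega> - p) / B)))\<^sup>2
    = a\<^sup>2 * (2 * pi * \<bar>B\<bar>) * (cmod (saft (A, B, C, D, p, q) (admissibility_fun (A, B, C, D, p, q) \<psi> a) (a * \<omega>)))\<^sup>2"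
proof -
  define phase where "phase = cis ((- 2 * (a * \<omega>) * (D * p - B * q) + D * ((a * \<omega>)\<^sup>2 + p\<^sup>2)) / (2 * B))"
  define I where "I = (\<integral>z. cnj (\<psi> (- z)) * cis (z * a * (p - \<omega>) / B) \<partial>lborel)"
  have "fourier (dilate_reflect \<psi> a) ((\<omega> - p) / B)
      = a *\<^sub>R (\<integral>z. dilate_reflect \<psi> a (0 + a * z) * cis (- ((\<omega> - p) / B * (0 + a * z))) \<partial>lborel)"
    unfolding fourier_def using assms by (subst lborel_integral_real_affine[of a _ 0]) auto
  also have "(\<integral>z. dilate_reflect \<psi> a (0 + a * z) * cis (- ((\<omega> - p) / B * (0 + a * z))) \<partial>lborel) = I"
    unfolding I_def
  proof (intro Bochner_Integration.integral_cong refl)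
    fix z
    have "- ((\<omega> - p) / B * (0 + a * z)) = z * a * (p - \<omega>) / B"
      using B by (simp add: field_simps)
    then show "dilate_reflect \<psi> a (0 + a * z) * cis (- ((\<omega> - p) / B * (0 + a * z)))
        = cnj (\<psi> (- z)) * cis (z * a * (p - \<omega>) / B)"
      using assms by (simp add: dilate_reflect_def)
  qed
  finally have fourier_eq: "fourier (dilate_reflect \<psi> a) ((\<omega> - p) / B) = a *\<^sub>R I" .
  have "saft (A, B, C, D, p, q) (admissibility_fun (A, B, C, D, p, q) \<psi> a) (a * \<omega>)
      = (\<integral>z. 1 / csqrt (\<i> * of_real (2 * pi * B)) * phase * (cnj (\<psi> (- z)) * cis (z * a * (p - \<omega>) / B)) \<partial>lborel)"
    unfolding saft_def
  proof (intro Bochner_Integration.integral_cong refl)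
    fix z
    let ?x = "(2 * z * p * (a - 1) - A * z\<^sup>2) / (2 * B)"
    let ?y = "(A * z\<^sup>2 + 2 * z * (p - a * \<omega>) - 2 * (a * \<omega>) * (D * p - B * q) + D * ((a * \<omega>)\<^sup>2 + p\<^sup>2)) / (2 * B)"
    let ?w = "(- 2 * (a * \<omega>) * (D * p - B * q) + D * ((a * \<omega>)\<^sup>2 + p\<^sup>2)) / (2 * B)"
    have "?x + ?y = ?w + z * a * (p - \<omega>) / B"
      using B by (simp add: field_simps)
    then have "cis ?x * cis ?y = phase * cis (z * a * (p - \<omega>) / B)"
      by (simp only: phase_def cis_mult)
    then show "admissibility_fun (A, B, C, D, p, q) \<psi> a z * saft_kernel (A, B, C, D, p, q) z (a * \<omega>)
        = 1 / csqrt (\<i> * of_real (2 * pi * B)) * phase * (cnj (\<psi> (- z)) * cis (z * a * (p - \<omega>) / B))"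
      unfolding admissibility_fun_cis saft_kernel_cis by (simp add: mult_ac)
  qed
  also have "\<dots> = 1 / csqrt (\<i> * of_real (2 * pi * B)) * phase * I"
    unfolding I_def by (rule integral_mult_right_zero)
  finally have "(cmod (saft (A, B, C, D, p, q) (admissibility_fun (A, B, C, D, p, q) \<psi> a) (a * \<omega>)))\<^sup>2
      = (cmod I)\<^sup>2 / (2 * pi * \<bar>B\<bar>)"
    by (simp add: norm_mult norm_divide power_mult_distrib power_divide phase_def abs_mult)
  then show ?thesis
    using B by (simp add: fourier_eq power_mult_distrib)
qed

text \<open>
  Plancherel's identity for the convolution, with the frequency written as \<open>(\<omega> - p) / B\<close>. The Jacobian
  \<open>1 / |B|\<close> of this substitution and the factor \<open>2 \<pi>\<close> of Plancherel cancel against the constant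
  \<open>2 \<pi> |B|\<close> of the previous lemma.
\<close>

lemma fixed_scale_energy_L1:
  assumes h: "bounded_continuous_L1 h" and \<psi>: "integrable lborel \<psi>" and a: "a > 0" and B: "B \<noteq> 0"
  shows "L2_energy lborel (convolution h (dilate_reflect \<psi> a)) = ennreal (a\<^sup>2) * L2_energy lborel
    (\<lambda>\<omega>. fourier h ((\<omega> - p) / B) * saft (A, B, C, D, p, q) (admissibility_fun (A, B, C, D, p, q) \<psi> a) (a * \<omega>))"
proof -
  have [measurable]: "h \<in> borel_measurable borel" using h by measurable
  note [measurable] = borel_measurable_integrable[OF \<psi>]
  define S where "S = saft (A, B, C, D, p, q) (admissibility_fun (A, B, C, D, p, q) \<psi> a)"
  have [measurable]: "S \<in> borel_measurable borel"
    unfolding S_def admissibility_fun_cis[abs_def] by measurable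
  let ?u = "dilate_reflect \<psi> a"
  have pt: "(cmod (fourier h ((\<omega> - p) / B) * fourier ?u ((\<omega> - p) / B)))\<^sup>2
     = (a\<^sup>2 * (2 * pi * \<bar>B\<bar>)) * (cmod (fourier h ((\<omega> - p) / B) * S (a * \<omega>)))\<^sup>2" for \<omega>
    unfolding norm_mult power_mult_distrib saft_admissibility_fun[OF a B, where A=A and C=C and D=D and q=q] S_def by simp
  have "ennreal (2 * pi) * L2_energy lborel (convolution h ?u)
      = L2_energy lborel (\<lambda>\<xi>. fourier h \<xi> * fourier ?u \<xi>)"
    by (rule convolution_energy[OF h integrable_dilate_reflect[OF \<psi> a]])
  also have "\<dots> = ennreal \<bar>1 / B\<bar> * L2_energy lborel (\<lambda>\<omega>. fourier h ((\<omega> - p) / B) * fourier ?u ((\<omega> - p) / B))"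
    using B by (subst energy_affine[of _ "1 / B" "- p / B"]) (auto simp: diff_divide_distrib)
  also have "L2_energy lborel (\<lambda>\<omega>. fourier h ((\<omega> - p) / B) * fourier ?u ((\<omega> - p) / B))
      = ennreal (a\<^sup>2 * (2 * pi * \<bar>B\<bar>)) * L2_energy lborel (\<lambda>\<omega>. fourier h ((\<omega> - p) / B) * S (a * \<omega>))"
    unfolding L2_energy_def pt by (subst ennreal_mult) (auto simp: nn_integral_cmult)
  also have "ennreal \<bar>1 / B\<bar> * (ennreal (a\<^sup>2 * (2 * pi * \<bar>B\<bar>)) * L2_energy lborel (\<lambda>\<omega>. fourier h ((\<omega> - p) / B) * S (a * \<omega>)))
      = ennreal (2 * pi) * (ennreal (a\<^sup>2) * L2_energy lborel (\<lambda>\<omega>. fourier h ((\<omega> - p) / B) * S (a * \<omega>)))"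
  proof -
    have "ennreal \<bar>1 / B\<bar> * ennreal (a\<^sup>2 * (2 * pi * \<bar>B\<bar>)) = ennreal (\<bar>1 / B\<bar> * (a\<^sup>2 * (2 * pi * \<bar>B\<bar>)))"
      by (rule ennreal_mult[symmetric]) auto
    also have "\<bar>1 / B\<bar> * (a\<^sup>2 * (2 * pi * \<bar>B\<bar>)) = 2 * pi * a\<^sup>2" using B by simp
    also have "ennreal (2 * pi * a\<^sup>2) = ennreal (2 * pi) * ennreal (a\<^sup>2)" by (rule ennreal_mult) auto
    finally show ?thesis by (simp only: mult.assoc[symmetric])
  qed
  finally show ?thesis
    by (simp add: S_def ennreal_mult_cancel_left)
qed


text \<open>
  The wavelet is only square integrable, and \<open>G\<close> is known only as the \<open>L\<^sup>2\<close> limit of transforms of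
  approximations. Restricting \<open>\<psi>\<close> to bounded intervals gives such approximations; the frequency side
  then converges in \<open>L\<^sup>2\<close> because the transform of \<open>h\<close> is bounded, and the convolutions converge
  pointwise.
\<close>

lemma fixed_scale_energy:
  assumes h: "bounded_continuous_L1 h" and \<psi>: "square_integrable lborel \<psi>" and a: "a > 0" and B: "B \<noteq> 0"
    and G: "is_saft_L2 (A, B, C, D, p, q) (admissibility_fun (A, B, C, D, p, q) \<psi> a) G"
  shows "L2_energy lborel (convolution h (dilate_reflect \<psi> a)) = ennreal (a\<^sup>2) * L2_energy lborel
    (\<lambda>\<omega>. fourier h ((\<omega> - p) / B) * G (a * \<omega>))"
proof -
  let ?M = "(A, B, C, D, p, q)"
  have [measurable]: "\<psi> \<in> borel_measurable borel" "h \<in> borel_measurable borel" "G \<in> borel_measurable borel"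
    using \<psi> h G by (auto simp: is_saft_L2_def square_integrable_def intro: bounded_continuous_L1_measurable)
  have G_sq: "square_integrable lborel G" using G by (simp add: is_saft_L2_def)
  define I :: "nat \<Rightarrow> real set" where "I n = {- real n..real n}" for n
  have [measurable]: "I n \<in> sets borel" for n by (simp add: I_def)
  define \<psi>n where "\<psi>n n x = indicator (I n) x * \<psi> x" for n x
  have [measurable]: "\<psi>n n \<in> borel_measurable borel" for n unfolding \<psi>n_def[abs_def] by measurable
  have \<psi>n_le: "cmod (\<psi>n n x) \<le> cmod (\<psi> x)" for n x by (simp add: \<psi>n_def indicator_def)
  have \<psi>n_eventually: "\<forall>\<^sub>F n in sequentially. \<psi>n n x = \<psi> x" for x
  proof -
    obtain m where m: "\<bar>x\<bar> \<le> real m" using real_arch_simple by blast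
    show ?thesis
    proof (rule eventually_sequentiallyI)
      fix n assume "m \<le> n"
      then have "\<bar>x\<bar> \<le> real n" using m by linarith
      then show "\<psi>n n x = \<psi> x" by (auto simp: \<psi>n_def I_def indicator_def)
    qed
  qed
  have \<psi>n_sq: "square_integrable lborel (\<psi>n n)" for n
    unfolding \<psi>n_def[abs_def] by (rule square_integrable_bounded_mult[OF \<psi>, where K=1]) (auto simp: indicator_def)
  have \<psi>n_int: "integrable lborel (\<psi>n n)" for n
  proof -
    have "integrable lborel (indicat_real (I n))"
      by (rule integrable_real_indicator) (auto simp: emeasure_lborel_Icc_eq I_def)
    moreover have "(cmod (indicator (I n) x))\<^sup>2 = indicat_real (I n) x" for x by (simp add: indicator_def)
    ultimately have "square_integrable lborel (\<lambda>x. indicator (I n) x :: complex)"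
      by (simp add: square_integrable_def)
    from square_integrable_inner_integrable[OF \<psi>n_sq this, of n] show ?thesis
      by (rule Bochner_Integration.integrable_cong[THEN iffD1, rotated -1]) (auto simp: \<psi>n_def indicator_def)
  qed
  define \<phi> where "\<phi> n = admissibility_fun ?M (\<psi>n n) a" for n
  have cmod_\<phi>: "cmod (admissibility_fun ?M f a z) = cmod (f (- z))" for f z
    unfolding admissibility_fun_cis by (simp add: norm_mult)
  have adm_meas [measurable]: "admissibility_fun ?M f a \<in> borel_measurable borel"
    if [measurable]: "f \<in> borel_measurable borel" for f
    unfolding admissibility_fun_cis[abs_def] by measurable
  have adm_int: "integrable lborel (admissibility_fun ?M f a)" if f: "integrable lborel f" for f
  proof (rule Bochner_Integration.integrable_bound)
    note [measurable] = borel_measurable_integrable[OF f]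
    show "integrable lborel (\<lambda>x. f (0 + - 1 * x))"
      using f by (intro lborel_integrable_real_affine) auto
    show "admissibility_fun ?M f a \<in> borel_measurable lborel" by measurable
  qed (auto simp: cmod_\<phi>)
  have adm_sq: "square_integrable lborel (admissibility_fun ?M f a)" if f: "square_integrable lborel f" for f
  proof -
    have [measurable]: "f \<in> borel_measurable borel" using f by (simp add: square_integrable_def)
    show ?thesis
      using square_integrable_affine[OF f, of "-1" 0] by (simp add: square_integrable_def cmod_\<phi>)
  qed
  have \<phi>_lim: "L2_lim lborel \<phi> (admissibility_fun ?M \<psi> a)"
  proof (rule L2_lim_dominated[where w="\<lambda>z. cmod (\<psi> (- z))"])
    show "integrable lborel (\<lambda>z. (cmod (\<psi> (- z)))\<^sup>2)"
      using square_integrable_affine[OF \<psi>, of "-1" 0] by (simp add: square_integrable_def)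
    show "AE z in lborel. (\<lambda>n. \<phi> n z) \<longlonglongrightarrow> admissibility_fun ?M \<psi> a z"
    proof (intro AE_I2 tendsto_eventually)
      fix z show "\<forall>\<^sub>F n in sequentially. \<phi> n z = admissibility_fun ?M \<psi> a z"
        using \<psi>n_eventually[of "- z"] by eventually_elim (simp only: \<phi>_def admissibility_fun_cis)
    qed
  qed (auto simp: \<phi>_def cmod_\<phi> \<psi>n_le)
  have saft_lim: "L2_lim lborel (\<lambda>n. saft ?M (\<phi> n)) G"
    by (rule G[unfolded is_saft_L2_def, THEN conjunct2, THEN conjunct2, rule_format])
       (simp add: \<phi>_lim, simp add: \<phi>_def adm_int[OF \<psi>n_int] adm_sq[OF \<psi>n_sq])
  define S where "S n = saft ?M (\<phi> n)" for n
  have [measurable]: "S n \<in> borel_measurable borel" for n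
    unfolding S_def \<phi>_def by measurable
  define m where "m \<omega> = fourier h ((\<omega> - p) / B)" for \<omega>
  have [measurable]: "m \<in> borel_measurable borel" unfolding m_def[abs_def] by measurable
  define K where "K = (\<integral>t. cmod (h t) \<partial>lborel)"
  have K: "cmod (m \<omega>) \<le> K" for \<omega> unfolding m_def K_def by (rule fourier_bound)
  define y where "y n = convolution h (dilate_reflect (\<psi>n n) a)" for n
  define x where "x n \<omega> = m \<omega> * S n (a * \<omega>)" for n \<omega>
  have energy_n: "L2_energy lborel (y n) = ennreal (a\<^sup>2) * L2_energy lborel (x n)" for n
    unfolding y_def x_def m_def S_def \<phi>_def by (rule fixed_scale_energy_L1[OF h \<psi>n_int a B])
  have dr: "integrable lborel (\<lambda>t. h t * dilate_reflect f a (b - t))" if f: "square_integrable lborel f" for f b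
  proof -
    have "square_integrable lborel (\<lambda>t. f (- b / a + 1 / a * t))"
      using a by (intro square_integrable_affine f) auto
    from square_integrable_inner_integrable[OF bounded_continuous_L1_square_integrable[OF h] this]
    have "integrable lborel (\<lambda>t. h t * cnj (f (- b / a + 1 / a * t)))" .
    moreover have "- b / a + 1 / a * t = - ((b - t) / a)" for t using a by (simp add: field_simps)
    ultimately show ?thesis by (simp add: dilate_reflect_def)
  qed
  have energy_diff: "L2_energy lborel (\<lambda>b. y n b - y k b) = ennreal (a\<^sup>2) * L2_energy lborel (\<lambda>\<omega>. x n \<omega> - x k \<omega>)" for n k
  proof -
    have "y n b - y k b = convolution h (dilate_reflect (\<lambda>t. \<psi>n n t - \<psi>n k t) a) b" for b
      unfolding y_def convolution_def
      using dr[OF \<psi>n_sq[of n], of b] dr[OF \<psi>n_sq[of k], of b]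
      by (subst Bochner_Integration.integral_diff[symmetric])
         (simp_all add: dilate_reflect_def right_diff_distrib)
    moreover have "x n \<omega> - x k \<omega>
        = m \<omega> * saft ?M (admissibility_fun ?M (\<lambda>t. \<psi>n n t - \<psi>n k t) a) (a * \<omega>)" for \<omega>
    proof -
      have "admissibility_fun ?M (\<lambda>t. \<psi>n n t - \<psi>n k t) a = (\<lambda>z. \<phi> n z - \<phi> k z)"
        unfolding \<phi>_def admissibility_fun_cis by (simp add: right_diff_distrib)
      then show ?thesis
        unfolding x_def S_def
        by (simp add: saft_diff[OF adm_int[OF \<psi>n_int] adm_int[OF \<psi>n_int]] \<phi>_def right_diff_distrib)
    qed
    moreover have "integrable lborel (\<lambda>t. \<psi>n n t - \<psi>n k t)"
      by (intro Bochner_Integration.integrable_diff \<psi>n_int)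
    ultimately show ?thesis
      using fixed_scale_energy_L1[OF h _ a B] by (simp add: m_def)
  qed
  have scaled: "square_integrable lborel (\<lambda>\<omega>. m \<omega> * f (a * \<omega>))" if f: "square_integrable lborel f" for f
    using square_integrable_affine[OF f, of a 0] a K
    by (intro square_integrable_bounded_mult[where K=K]) auto
  have x_sq: "square_integrable lborel (x n)" for n
  proof -
    have "bounded_continuous_L1 (y n)"
      unfolding y_def by (intro bounded_continuous_L1_convolution h integrable_dilate_reflect \<psi>n_int a)
    then have "L2_energy lborel (y n) < \<infinity>"
      using bounded_continuous_L1_square_integrable square_integrable_energy_iff by blast
    then have "ennreal (a\<^sup>2) * L2_energy lborel (x n) < \<infinity>" by (simp only: energy_n)
    then have "L2_energy lborel (x n) < \<infinity>" using a by (auto simp: ennreal_mult_less_top)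
    moreover have "x n \<in> borel_measurable lborel" unfolding x_def[abs_def] by measurable
    ultimately show ?thesis by (simp add: square_integrable_energy_iff)
  qed
  have x_lim: "L2_lim lborel x (\<lambda>\<omega>. m \<omega> * G (a * \<omega>))"
    unfolding L2_lim_energy
  proof (rule tendsto_sandwich[OF _ _ tendsto_const])
    show "\<forall>\<^sub>F n in sequentially. L2_energy lborel (\<lambda>\<omega>. x n \<omega> - m \<omega> * G (a * \<omega>))
        \<le> ennreal (K\<^sup>2 * (1 / a)) * L2_energy lborel (\<lambda>\<omega>. S n \<omega> - G \<omega>)"
    proof (rule always_eventually, rule allI)
      fix n
      have "L2_energy lborel (\<lambda>\<omega>. x n \<omega> - m \<omega> * G (a * \<omega>))
          \<le> L2_energy lborel (\<lambda>\<omega>. complex_of_real K * (S n (a * \<omega>) - G (a * \<omega>)))"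
        unfolding L2_energy_def
      proof (intro nn_integral_mono ennreal_leI power_mono)
        fix \<omega>
        have "cmod (x n \<omega> - m \<omega> * G (a * \<omega>)) = cmod (m \<omega>) * cmod (S n (a * \<omega>) - G (a * \<omega>))"
          by (simp add: x_def right_diff_distrib[symmetric] norm_mult)
        also have "\<dots> \<le> \<bar>K\<bar> * cmod (S n (a * \<omega>) - G (a * \<omega>))"
          by (rule mult_right_mono[OF order_trans[OF K abs_ge_self]]) simp
        finally show "cmod (x n \<omega> - m \<omega> * G (a * \<omega>)) \<le> cmod (complex_of_real K * (S n (a * \<omega>) - G (a * \<omega>)))"
          by (simp add: norm_mult)
      qed simp
      also have "\<dots> = ennreal (K\<^sup>2) * L2_energy lborel (\<lambda>\<omega>. S n (a * \<omega>) - G (a * \<omega>))"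
        by (subst energy_cmult) auto
      also have "L2_energy lborel (\<lambda>\<omega>. S n (a * \<omega>) - G (a * \<omega>))
          = ennreal (1 / a) * L2_energy lborel (\<lambda>\<omega>. S n \<omega> - G \<omega>)"
        using a by (subst energy_affine[of _ "1 / a" 0]) auto
      also have "ennreal (K\<^sup>2) * (ennreal (1 / a) * L2_energy lborel (\<lambda>\<omega>. S n \<omega> - G \<omega>))
          = ennreal (K\<^sup>2 * (1 / a)) * L2_energy lborel (\<lambda>\<omega>. S n \<omega> - G \<omega>)"
        using a by (subst ennreal_mult) (auto simp: mult.assoc)
      finally show "L2_energy lborel (\<lambda>\<omega>. x n \<omega> - m \<omega> * G (a * \<omega>))
          \<le> ennreal (K\<^sup>2 * (1 / a)) * L2_energy lborel (\<lambda>\<omega>. S n \<omega> - G \<omega>)" .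
    qed
    have "(\<lambda>n. ennreal (K\<^sup>2 * (1 / a)) * L2_energy lborel (\<lambda>\<omega>. S n \<omega> - G \<omega>)) \<longlonglongrightarrow> ennreal (K\<^sup>2 * (1 / a)) * 0"
      using saft_lim by (intro ennreal_tendsto_cmult) (auto simp: L2_lim_energy S_def)
    then show "(\<lambda>n. ennreal (K\<^sup>2 * (1 / a)) * L2_energy lborel (\<lambda>\<omega>. S n \<omega> - G \<omega>)) \<longlonglongrightarrow> 0" by simp
  qed auto
  have y_lim: "(\<lambda>n. y n b) \<longlonglongrightarrow> convolution h (dilate_reflect \<psi> a) b" for b
    unfolding y_def convolution_def
  proof (rule integral_dominated_convergence[where w="\<lambda>t. norm (h t * dilate_reflect \<psi> a (b - t))"])
    show "integrable lborel (\<lambda>t. norm (h t * dilate_reflect \<psi> a (b - t)))"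
      by (intro integrable_norm dr \<psi>)
    show "AE t in lborel. (\<lambda>n. h t * dilate_reflect (\<psi>n n) a (b - t)) \<longlonglongrightarrow> h t * dilate_reflect \<psi> a (b - t)"
    proof (intro AE_I2 tendsto_eventually)
      fix t
      show "\<forall>\<^sub>F n in sequentially. h t * dilate_reflect (\<psi>n n) a (b - t) = h t * dilate_reflect \<psi> a (b - t)"
        using \<psi>n_eventually[of "- ((b - t) / a)"] by eventually_elim (simp only: dilate_reflect_def)
    qed
    show "AE t in lborel. norm (h t * dilate_reflect (\<psi>n n) a (b - t)) \<le> norm (h t * dilate_reflect \<psi> a (b - t))" for n
      using \<psi>n_le by (intro AE_I2) (simp add: norm_mult dilate_reflect_def mult_left_mono)
  qed measurable
  have "L2_energy lborel (convolution h (dilate_reflect \<psi> a)) = ennreal (a\<^sup>2) * L2_energy lborel (\<lambda>\<omega>. m \<omega> * G (a * \<omega>))"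
    by (rule L2_isometry_limit(2)[OF x_sq scaled[OF G_sq] x_lim _ _ _ energy_n energy_diff])
       (use y_lim in \<open>auto simp: y_def\<close>)
  then show ?thesis by (simp add: m_def)
qed

section \<open>The wavelet transform as a multiple of an isometry\<close>

lemma nn_integral_half_plane:
  assumes [measurable]: "F \<in> borel_measurable (lborel \<Otimes>\<^sub>M lborel)"
  shows "(\<integral>\<^sup>+x. F x \<partial>half_plane_measure)
    = (\<integral>\<^sup>+a. indicator {0<..} a * (ennreal (1 / a\<^sup>2) * (\<integral>\<^sup>+b. F (b, a) \<partial>lborel)) \<partial>lborel)"
proof -
  let ?P = "lborel \<Otimes>\<^sub>M lborel :: (real \<times> real) measure"
  have sets [measurable]: "(UNIV :: real set) \<times> {0 :: real<..} \<in> sets ?P"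
    by (intro pair_measureI) auto
  have "(\<integral>\<^sup>+x. F x \<partial>half_plane_measure)
      = (\<integral>\<^sup>+x. (case x of (b, a) \<Rightarrow> ennreal (1 / a\<^sup>2)) * F x \<partial>restrict_space ?P (UNIV \<times> {0<..}))"
    unfolding half_plane_measure_def
    by (subst nn_integral_density) (auto intro!: measurable_restrict_space1)
  also have "\<dots> = (\<integral>\<^sup>+x. (case x of (b, a) \<Rightarrow> ennreal (1 / a\<^sup>2)) * F x * indicator (UNIV \<times> {0<..}) x \<partial>?P)"
    by (subst nn_integral_restrict_space) (use sets in auto)
  also have "\<dots> = (\<integral>\<^sup>+a. \<integral>\<^sup>+b. ennreal (1 / a\<^sup>2) * F (b, a) * indicator (UNIV \<times> {0<..}) (b, a) \<partial>lborel \<partial>lborel)"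
    by (subst lborel_pair.nn_integral_snd[symmetric]) (auto intro!: nn_integral_cong)
  also have "\<dots> = (\<integral>\<^sup>+a. indicator {0<..} a * (ennreal (1 / a\<^sup>2) * (\<integral>\<^sup>+b. F (b, a) \<partial>lborel)) \<partial>lborel)"
    by (intro nn_integral_cong) (auto simp: nn_integral_cmult indicator_def)
  finally show ?thesis .
qed

lemma measurable_half_plane:
  "F \<in> borel_measurable (lborel \<Otimes>\<^sub>M lborel) \<Longrightarrow> F \<in> borel_measurable half_plane_measure"
  unfolding half_plane_measure_def by (auto intro!: measurable_restrict_space1)

lemma AE_half_plane_pos: "AE x in half_plane_measure. 0 < snd x"
  by (rule AE_I2) (auto simp: half_plane_measure_def space_restrict_space)

lemma square_integrable_sa_wavelet:
  assumes \<psi>: "square_integrable lborel \<psi>" and a: "a > 0"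
  shows "square_integrable lborel (sa_wavelet M \<psi> b a)"
proof -
  obtain A B C D p q where M: "M = (A, B, C, D, p, q)" by (metis surj_pair)
  define c where "c t = 1 / csqrt (\<i> * of_real (2 * pi * a * B)) *
     cis (- ((A * t\<^sup>2 + D * p\<^sup>2 - A * (b / a)\<^sup>2) / (2 * B)))" for t
  have "square_integrable lborel (\<lambda>t. \<psi> (- b / a + 1 / a * t))"
    using a by (intro square_integrable_affine \<psi>) auto
  then have "square_integrable lborel (\<lambda>t. c t * \<psi> (- b / a + 1 / a * t))"
    by (rule square_integrable_bounded_mult[where K="cmod (1 / csqrt (\<i> * of_real (2 * pi * a * B)))"])
       (simp_all add: c_def[abs_def] norm_mult norm_divide)
  moreover have "c t * \<psi> (- b / a + 1 / a * t) = sa_wavelet M \<psi> b a t" for t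
    unfolding M sa_wavelet_cis c_def by (simp add: diff_divide_distrib add.commute)
  ultimately show ?thesis by simp
qed

lemma sa_wavelet_transform_inner:
  "sa_wavelet_transform M \<psi> g b a = L2_inner lborel g (sa_wavelet M \<psi> b a)"
  by (simp add: sa_wavelet_transform_def L2_inner_def)

text \<open>
  The chirp in \<open>t\<close> is absorbed into the signal; the remaining phase depends on \<open>(b, a)\<close> only.
\<close>

lemma sa_wavelet_transform_convolution:
  assumes B: "B \<noteq> 0" and a: "a > 0"
  shows "(cmod (sa_wavelet_transform (A, B, C, D, p, q) \<psi> g b a))\<^sup>2 = 1 / (2 * pi * a * \<bar>B\<bar>) *
    (cmod (convolution (\<lambda>t. cis (A * t\<^sup>2 / (2 * B)) * g t) (dilate_reflect \<psi> a) b))\<^sup>2"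
proof -
  define \<kappa> where "\<kappa> = cnj (1 / csqrt (\<i> * of_real (2 * pi * a * B))) * cis ((D * p\<^sup>2 - A * (b / a)\<^sup>2) / (2 * B))"
  have "sa_wavelet_transform (A, B, C, D, p, q) \<psi> g b a
     = (\<integral>t. \<kappa> * (cis (A * t\<^sup>2 / (2 * B)) * g t * dilate_reflect \<psi> a (b - t)) \<partial>lborel)"
    unfolding sa_wavelet_transform_def
  proof (intro Bochner_Integration.integral_cong refl)
    fix t
    have "(A * t\<^sup>2 + D * p\<^sup>2 - A * (b / a)\<^sup>2) / (2 * B) = (D * p\<^sup>2 - A * (b / a)\<^sup>2) / (2 * B) + A * t\<^sup>2 / (2 * B)"
      by (simp add: diff_divide_distrib add_divide_distrib)
    then have "cis ((A * t\<^sup>2 + D * p\<^sup>2 - A * (b / a)\<^sup>2) / (2 * B))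
        = cis ((D * p\<^sup>2 - A * (b / a)\<^sup>2) / (2 * B)) * cis (A * t\<^sup>2 / (2 * B))"
      by (simp only: cis_mult)
    moreover have "- ((b - t) / a) = (t - b) / a" by (simp add: diff_divide_distrib)
    ultimately show "g t * cnj (sa_wavelet (A, B, C, D, p, q) \<psi> b a t)
        = \<kappa> * (cis (A * t\<^sup>2 / (2 * B)) * g t * dilate_reflect \<psi> a (b - t))"
      unfolding sa_wavelet_cis \<kappa>_def dilate_reflect_def by (simp add: cis_cnj mult_ac)
  qed
  also have "\<dots> = \<kappa> * convolution (\<lambda>t. cis (A * t\<^sup>2 / (2 * B)) * g t) (dilate_reflect \<psi> a) b"
    unfolding convolution_def by (rule integral_mult_right_zero)
  finally show ?thesis
    using a by (simp add: \<kappa>_def norm_mult norm_divide power_mult_distrib power_divide abs_mult mult_ac)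
qed

lemma measurable_sa_wavelet_transform:
  assumes [measurable]: "\<psi> \<in> borel_measurable borel" "g \<in> borel_measurable borel"
  shows "(\<lambda>(b, a). sa_wavelet_transform M \<psi> g b a) \<in> borel_measurable (lborel \<Otimes>\<^sub>M lborel)"
proof -
  obtain A B C D p q where M: "M = (A, B, C, D, p, q)" by (metis surj_pair)
  show ?thesis unfolding M sa_wavelet_transform_def sa_wavelet_cis by measurable
qed

text \<open>
  The transform as one function on pairs, the form in which it is a vector of \<open>L\<^sup>2\<close> over the half plane.
\<close>

definition wavelet_image ::
    "saft_params \<Rightarrow> (real \<Rightarrow> complex) \<Rightarrow> (real \<Rightarrow> complex) \<Rightarrow> real \<times> real \<Rightarrow> complex" where
  "wavelet_image M \<psi> g = (\<lambda>(b, a). sa_wavelet_transform M \<psi> g b a)"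

text \<open>
  The energy of each slice is known from the fixed-scale identity. After Tonelli's theorem the inner
  integral over \<open>a\<close> is the admissibility integral, which equals \<open>c\<close> for almost every \<open>\<omega>\<close>; the weights
  \<open>1 / a\<^sup>2\<close> of the measure, \<open>1 / a\<close> of the normalisation and \<open>a\<^sup>2\<close> of the dilation combine to its \<open>1 / a\<close>.
  Plancherel's identity for \<open>h\<close> finishes the computation.
\<close>

lemma wavelet_transform_energy_bounded_continuous_L1:
  assumes B: "B \<noteq> 0" and \<psi>: "square_integrable lborel \<psi>"
    and adm: "admissible_with_constant (A, B, C, D, p, q) \<psi> c"
    and g: "bounded_continuous_L1 g"
  shows "L2_energy half_plane_measure (wavelet_image (A, B, C, D, p, q) \<psi> g) = ennreal c * L2_energy lborel g"
proof -
  let ?M = "(A, B, C, D, p, q)"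
  obtain G where G_meas: "(\<lambda>(a, \<omega>). G a \<omega>) \<in> borel_measurable (lborel \<Otimes>\<^sub>M lborel)"
    and G: "\<And>a. a > 0 \<Longrightarrow> is_saft_L2 ?M (admissibility_fun ?M \<psi> a) (G a)"
    and G_c: "AE \<omega> in lborel. (\<integral>\<^sup>+a\<in>{0<..}. ennreal (1 / a * (cmod (G a (a * \<omega>)))\<^sup>2) \<partial>lborel) = ennreal c"
    and c: "0 \<le> c"
    using adm unfolding admissible_with_constant_def by blast
  have [measurable (raw)]: "(\<lambda>x. G (u x) (v x)) \<in> borel_measurable N"
    if "u \<in> borel_measurable N" "v \<in> borel_measurable N" for u v and N :: "'z measure"
  proof -
    have "(\<lambda>x. (u x, v x)) \<in> N \<rightarrow>\<^sub>M lborel \<Otimes>\<^sub>M lborel"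
      using that by (intro measurable_Pair) auto
    from measurable_compose[OF this G_meas] show ?thesis by simp
  qed
  define h where "h t = cis (A * t\<^sup>2 / (2 * B)) * g t" for t
  have h: "bounded_continuous_L1 h"
    unfolding h_def[abs_def]
    using B by (intro bounded_continuous_L1_unimodular_mult[OF g]) (auto intro!: continuous_intros)
  have [measurable]: "\<psi> \<in> borel_measurable borel" "g \<in> borel_measurable borel" "h \<in> borel_measurable borel"
    using \<psi> g h by (auto simp: square_integrable_def intro: bounded_continuous_L1_measurable)
  define m where "m \<omega> = ennreal ((cmod (fourier h ((\<omega> - p) / B)))\<^sup>2)" for \<omega>
  have [measurable]: "m \<in> borel_measurable borel" unfolding m_def[abs_def] by measurable
  \<comment> \<open>squared modulus of the normalising factor of the wavelets, without its dependence on \<open>a\<close>\<close>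
  define k where "k = 1 / (2 * pi * \<bar>B\<bar>)"
  have k: "k > 0" using B by (simp add: k_def)
  have slice: "ennreal (1 / a\<^sup>2) * (\<integral>\<^sup>+b. ennreal ((cmod (sa_wavelet_transform ?M \<psi> g b a))\<^sup>2) \<partial>lborel)
      = ennreal k * (\<integral>\<^sup>+\<omega>. m \<omega> * ennreal (1 / a * (cmod (G a (a * \<omega>)))\<^sup>2) \<partial>lborel)" if a: "a > 0" for a
  proof -
    have "(\<integral>\<^sup>+b. ennreal ((cmod (sa_wavelet_transform ?M \<psi> g b a))\<^sup>2) \<partial>lborel)
        = ennreal (k / a) * L2_energy lborel (convolution h (dilate_reflect \<psi> a))"
      unfolding sa_wavelet_transform_convolution[OF B a] h_def[symmetric] L2_energy_def
      using a B by (subst nn_integral_cmult[symmetric]) (auto simp: k_def ennreal_mult[symmetric] mult_ac)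
    also have "\<dots> = ennreal (k / a) * (ennreal (a\<^sup>2) * L2_energy lborel (\<lambda>\<omega>. fourier h ((\<omega> - p) / B) * G a (a * \<omega>)))"
      by (simp only: fixed_scale_energy[OF h \<psi> a B G[OF a]])
    finally have "ennreal (1 / a\<^sup>2) * (\<integral>\<^sup>+b. ennreal ((cmod (sa_wavelet_transform ?M \<psi> g b a))\<^sup>2) \<partial>lborel)
        = (ennreal (1 / a\<^sup>2) * ennreal (k / a) * ennreal (a\<^sup>2)) * L2_energy lborel (\<lambda>\<omega>. fourier h ((\<omega> - p) / B) * G a (a * \<omega>))"
      by (simp only: mult.assoc)
    also have "ennreal (1 / a\<^sup>2) * ennreal (k / a) * ennreal (a\<^sup>2) = ennreal k * ennreal (1 / a)"
      using a k by (simp add: ennreal_mult[symmetric] field_simps)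
    also have "ennreal k * ennreal (1 / a) * L2_energy lborel (\<lambda>\<omega>. fourier h ((\<omega> - p) / B) * G a (a * \<omega>))
        = ennreal k * (\<integral>\<^sup>+\<omega>. m \<omega> * ennreal (1 / a * (cmod (G a (a * \<omega>)))\<^sup>2) \<partial>lborel)"
      unfolding L2_energy_def mult.assoc using a
      by (subst nn_integral_cmult[symmetric])
         (auto simp: m_def norm_mult power_mult_distrib ennreal_mult[symmetric] mult_ac)
    finally show ?thesis .
  qed
  have "L2_energy half_plane_measure (wavelet_image ?M \<psi> g)
      = (\<integral>\<^sup>+a. indicator {0<..} a * (ennreal (1 / a\<^sup>2) * (\<integral>\<^sup>+b. ennreal ((cmod (sa_wavelet_transform ?M \<psi> g b a))\<^sup>2) \<partial>lborel)) \<partial>lborel)"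
    unfolding L2_energy_def
  proof (subst nn_integral_half_plane)
    show "(\<lambda>x. ennreal ((cmod (wavelet_image ?M \<psi> g x))\<^sup>2)) \<in> borel_measurable (lborel \<Otimes>\<^sub>M lborel)"
      using measurable_sa_wavelet_transform[of \<psi> g ?M] unfolding wavelet_image_def by measurable
  qed (simp add: wavelet_image_def)
  also have "\<dots> = (\<integral>\<^sup>+a. indicator {0<..} a * (ennreal k * (\<integral>\<^sup>+\<omega>. m \<omega> * ennreal (1 / a * (cmod (G a (a * \<omega>)))\<^sup>2) \<partial>lborel)) \<partial>lborel)"
    by (intro nn_integral_cong) (auto simp: slice split: split_indicator)
  also have "\<dots> = (\<integral>\<^sup>+a. \<integral>\<^sup>+\<omega>. ennreal k * (m \<omega> * (ennreal (1 / a * (cmod (G a (a * \<omega>)))\<^sup>2) * indicator {0<..} a)) \<partial>lborel \<partial>lborel)"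
    by (intro nn_integral_cong) (auto simp: nn_integral_cmult split: split_indicator)
  also have "\<dots> = (\<integral>\<^sup>+\<omega>. \<integral>\<^sup>+a. ennreal k * (m \<omega> * (ennreal (1 / a * (cmod (G a (a * \<omega>)))\<^sup>2) * indicator {0<..} a)) \<partial>lborel \<partial>lborel)"
    by (rule lborel_pair.Fubini') measurable
  also have "\<dots> = (\<integral>\<^sup>+\<omega>. ennreal k * (m \<omega> * (\<integral>\<^sup>+a\<in>{0<..}. ennreal (1 / a * (cmod (G a (a * \<omega>)))\<^sup>2) \<partial>lborel)) \<partial>lborel)"
    by (intro nn_integral_cong) (simp add: nn_integral_cmult)
  also have "\<dots> = (\<integral>\<^sup>+\<omega>. ennreal k * (m \<omega> * ennreal c) \<partial>lborel)"
    using G_c by (intro nn_integral_cong_AE) auto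
  also have "\<dots> = ennreal k * ennreal c * L2_energy lborel (\<lambda>\<omega>. fourier h ((\<omega> - p) / B))"
    by (simp add: nn_integral_cmult nn_integral_multc m_def[abs_def] L2_energy_def mult_ac)
  also have "L2_energy lborel (\<lambda>\<omega>. fourier h ((\<omega> - p) / B)) = ennreal \<bar>B\<bar> * L2_energy lborel (fourier h)"
    using B by (subst energy_affine[of _ B p]) auto
  also have "L2_energy lborel (fourier h) = ennreal (2 * pi) * L2_energy lborel h"
    by (rule Plancherel_bounded_continuous_L1[OF h])
  also have "L2_energy lborel h = L2_energy lborel g"
    by (simp add: L2_energy_def h_def norm_mult)
  also have "ennreal k * ennreal c * (ennreal \<bar>B\<bar> * (ennreal (2 * pi) * L2_energy lborel g))
      = ennreal (k * c * \<bar>B\<bar> * (2 * pi)) * L2_energy lborel g"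
    using k c by (simp add: ennreal_mult mult.assoc)
  also have "k * c * \<bar>B\<bar> * (2 * pi) = c"
    using B by (simp add: k_def)
  finally show ?thesis .
qed

text \<open>
  Where \<open>a > 0\<close> the wavelets are square integrable; this makes the integrals of both summands converge.
\<close>

lemma wavelet_image_add:
  assumes "square_integrable lborel \<psi>" "square_integrable lborel g" "square_integrable lborel k" "0 < snd x"
  shows "wavelet_image M \<psi> (\<lambda>t. g t + k t) x = wavelet_image M \<psi> g x + wavelet_image M \<psi> k x"
  using assms by (cases x)
    (simp add: wavelet_image_def sa_wavelet_transform_inner L2_inner_add_left square_integrable_sa_wavelet)

lemma wavelet_image_diff:
  assumes "square_integrable lborel \<psi>" "square_integrable lborel g" "square_integrable lborel k" "0 < snd x"
  shows "wavelet_image M \<psi> (\<lambda>t. g t - k t) x = wavelet_image M \<psi> g x - wavelet_image M \<psi> k x"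
  using assms by (cases x)
    (simp add: wavelet_image_def sa_wavelet_transform_inner L2_inner_diff_left square_integrable_sa_wavelet)

lemma wavelet_image_cmult:
  "wavelet_image M \<psi> (\<lambda>t. c * g t) x = c * wavelet_image M \<psi> g x"
  by (cases x) (simp add: wavelet_image_def sa_wavelet_transform_inner L2_inner_cmult_left)

text \<open>
  Approximation of \<open>g\<close> by test functions. The transform at a given point is an inner product with a
  square-integrable wavelet, so it converges pointwise when the signals converge in \<open>L\<^sup>2\<close>.
\<close>

lemma wavelet_transform_isometry:
  assumes B: "B \<noteq> 0" and \<psi>: "square_integrable lborel \<psi>"
    and adm: "admissible_with_constant (A, B, C, D, p, q) \<psi> c"
    and g: "square_integrable lborel g"
  shows "square_integrable half_plane_measure (wavelet_image (A, B, C, D, p, q) \<psi> g)"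
    and "L2_energy half_plane_measure (wavelet_image (A, B, C, D, p, q) \<psi> g) = ennreal c * L2_energy lborel g"
proof -
  let ?W = "wavelet_image (A, B, C, D, p, q) \<psi>"
  obtain h where h: "\<And>n. bounded_continuous_L1 (h n)" and h_lim: "L2_lim lborel h g"
    using bounded_continuous_L1_dense[OF g] by metis
  have h_sq: "square_integrable lborel (h n)" for n
    by (rule bounded_continuous_L1_square_integrable[OF h])
  have meas: "?W k \<in> borel_measurable half_plane_measure" if "square_integrable lborel k" for k
    using measurable_sa_wavelet_transform[of \<psi> k "(A, B, C, D, p, q)"] \<psi> that unfolding wavelet_image_def
    by (intro measurable_half_plane) (simp add: square_integrable_def)
  have ptw: "AE x in half_plane_measure. (\<lambda>n. ?W (h n) x) \<longlonglongrightarrow> ?W g x"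
    using AE_half_plane_pos
  proof eventually_elim
    fix x :: "real \<times> real" assume "0 < snd x"
    then show "(\<lambda>n. ?W (h n) x) \<longlonglongrightarrow> ?W g x"
      using L2_lim_inner_left[OF h_sq g square_integrable_sa_wavelet[OF \<psi>] h_lim]
      by (cases x) (simp add: wavelet_image_def sa_wavelet_transform_inner)
  qed
  have diff: "L2_energy half_plane_measure (\<lambda>x. ?W (h n) x - ?W (h m) x)
      = ennreal c * L2_energy lborel (\<lambda>t. h n t - h m t)" for n m
  proof -
    have "L2_energy half_plane_measure (\<lambda>x. ?W (h n) x - ?W (h m) x)
        = L2_energy half_plane_measure (?W (\<lambda>t. h n t - h m t))"
      using AE_half_plane_pos
      by (intro L2_energy_cong_AE, eventually_elim) (simp add: wavelet_image_diff \<psi> h_sq)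
    then show ?thesis
      by (simp only: wavelet_transform_energy_bounded_continuous_L1[OF B \<psi> adm bounded_continuous_L1_diff[OF h h]])
  qed
  note limit = L2_isometry_limit[OF h_sq g h_lim meas[OF h_sq] meas[OF g] ptw
    wavelet_transform_energy_bounded_continuous_L1[OF B \<psi> adm h] diff]
  show "square_integrable half_plane_measure (?W g)" by (rule limit(1))
  show "L2_energy half_plane_measure (?W g) = ennreal c * L2_energy lborel g" by (rule limit(2))
qed

lemma wavelet_transform_sqnorm:
  assumes "B \<noteq> 0" and "square_integrable lborel \<psi>"
    and adm: "admissible_with_constant (A, B, C, D, p, q) \<psi> c"
    and g: "square_integrable lborel g"
  shows "L2_sqnorm half_plane_measure (wavelet_image (A, B, C, D, p, q) \<psi> g) = c * L2_sqnorm lborel g"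
proof -
  have "0 \<le> c" using adm by (simp add: admissible_with_constant_def)
  then have "ennreal (L2_sqnorm half_plane_measure (wavelet_image (A, B, C, D, p, q) \<psi> g))
      = ennreal (c * L2_sqnorm lborel g)"
    using wavelet_transform_isometry[OF assms] g by (simp add: energy_eq_sqnorm ennreal_mult)
  with \<open>0 \<le> c\<close> show ?thesis by simp
qed

text \<open>
  Polarisation: the norm of \<open>g + k\<close> determines the real part of the inner product, and replacing \<open>k\<close> by
  \<open>\<i> k\<close> gives the imaginary part.
\<close>

lemma wavelet_transform_inner:
  assumes B: "B \<noteq> 0" and \<psi>: "square_integrable lborel \<psi>"
    and adm: "admissible_with_constant (A, B, C, D, p, q) \<psi> c"
    and g: "square_integrable lborel g" and k: "square_integrable lborel k"
  shows "L2_inner half_plane_measure (wavelet_image (A, B, C, D, p, q) \<psi> g) (wavelet_image (A, B, C, D, p, q) \<psi> k)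
    = complex_of_real c * L2_inner lborel g k"
proof -
  let ?W = "wavelet_image (A, B, C, D, p, q) \<psi>"
  let ?H = half_plane_measure
  note sq = wavelet_transform_isometry(1)[OF B \<psi> adm]
  note norm = wavelet_transform_sqnorm[OF B \<psi> adm]
  have Re_eq: "Re (L2_inner ?H (?W g) (?W k)) = c * Re (L2_inner lborel g k)" if k: "square_integrable lborel k" for k
  proof -
    have "L2_sqnorm ?H (\<lambda>x. ?W g x + ?W k x) = L2_sqnorm ?H (?W (\<lambda>t. g t + k t))"
    proof (rule L2_sqnorm_cong_AE)
      show "AE x in ?H. ?W g x + ?W k x = ?W (\<lambda>t. g t + k t) x"
        using AE_half_plane_pos by eventually_elim (simp add: wavelet_image_add \<psi> g k)
    qed (intro square_integrable_measurable square_integrable_add sq g k)+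
    then have "L2_sqnorm ?H (?W g) + L2_sqnorm ?H (?W k) + 2 * Re (L2_inner ?H (?W g) (?W k))
        = c * (L2_sqnorm lborel g + L2_sqnorm lborel k + 2 * Re (L2_inner lborel g k))"
      using L2_sqnorm_add[OF sq[OF g] sq[OF k]] L2_sqnorm_add[OF g k] norm[OF square_integrable_add[OF g k]]
      by simp
    then show ?thesis by (simp add: norm g k algebra_simps)
  qed
  have "?W (\<lambda>t. \<i> * k t) = (\<lambda>x. \<i> * ?W k x)" by (rule ext) (rule wavelet_image_cmult)
  then have "Im (L2_inner ?H (?W g) (?W k)) = c * Im (L2_inner lborel g k)"
    using Re_eq[OF square_integrable_cmult[OF k, of \<i>]] by (simp add: L2_inner_cmult_right)
  with Re_eq[OF k] show ?thesis by (simp add: complex_eq_iff)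
qed

section \<open>The range of the wavelet transform\<close>

text \<open>
  Since \<open>c > 0\<close>, a Cauchy sequence of transforms comes from a Cauchy sequence of signals.
\<close>

lemma wavelet_range_complete:
  assumes B: "B \<noteq> 0" and \<psi>: "square_integrable lborel \<psi>"
    and adm: "admissible_with_constant (A, B, C, D, p, q) \<psi> c" and c: "c > 0"
    and k: "\<And>n. square_integrable lborel (k n)"
    and Cau: "L2_Cauchy half_plane_measure (\<lambda>n. wavelet_image (A, B, C, D, p, q) \<psi> (k n))"
  obtains r v where "strict_mono r" "square_integrable lborel v"
    "L2_lim half_plane_measure (\<lambda>n. wavelet_image (A, B, C, D, p, q) \<psi> (k (r n))) (wavelet_image (A, B, C, D, p, q) \<psi> v)"
proof -
  let ?W = "wavelet_image (A, B, C, D, p, q) \<psi>"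
  let ?H = half_plane_measure
  note sq = wavelet_transform_isometry(1)[OF B \<psi> adm]
  have diff: "L2_sqnorm ?H (\<lambda>x. ?W u x - ?W v x) = c * L2_sqnorm lborel (\<lambda>t. u t - v t)"
    if u: "square_integrable lborel u" and v: "square_integrable lborel v" for u v
  proof -
    have "L2_sqnorm ?H (\<lambda>x. ?W u x - ?W v x) = L2_sqnorm ?H (?W (\<lambda>t. u t - v t))"
    proof (rule L2_sqnorm_cong_AE)
      show "AE x in ?H. ?W u x - ?W v x = ?W (\<lambda>t. u t - v t) x"
        using AE_half_plane_pos by eventually_elim (simp add: wavelet_image_diff \<psi> u v)
    qed (intro square_integrable_measurable square_integrable_diff sq u v)+
    then show ?thesis by (simp add: wavelet_transform_sqnorm[OF B \<psi> adm] square_integrable_diff u v)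
  qed
  have "L2_Cauchy lborel k"
    unfolding L2_Cauchy_def
  proof (intro allI impI)
    fix e :: real assume "e > 0"
    then have "c * e > 0" using c by simp
    with Cau obtain M where M: "\<And>i j. i \<ge> M \<Longrightarrow> j \<ge> M \<Longrightarrow> L2_sqnorm ?H (\<lambda>x. ?W (k i) x - ?W (k j) x) < c * e"
      unfolding L2_Cauchy_def by blast
    have "L2_sqnorm lborel (\<lambda>x. k i x - k j x) < e" if "i \<ge> M" "j \<ge> M" for i j
      using M[OF that] c unfolding diff[OF k k] by simp
    then show "\<exists>M. \<forall>i\<ge>M. \<forall>j\<ge>M. L2_sqnorm lborel (\<lambda>x. k i x - k j x) < e" by blast
  qed
  from L2_lborel_complete[OF k this]
  obtain r v where r: "strict_mono r" and v: "square_integrable lborel v" and lim: "L2_lim lborel (\<lambda>n. k (r n)) v" .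
  have "(\<lambda>n. c * L2_sqnorm lborel (\<lambda>t. k (r n) t - v t)) \<longlonglongrightarrow> c * 0"
    using lim by (intro tendsto_intros) (simp add: L2_lim_sqnorm_iff k v)
  then have "L2_lim ?H (\<lambda>n. ?W (k (r n))) (?W v)"
    by (simp add: L2_lim_sqnorm_iff sq k v diff)
  with r v show thesis by (rule that)
qed

theorem theorem3p5:
  fixes A B C D p q C\<^sub>\<psi> :: real
    and \<psi> :: "real \<Rightarrow> complex"
    and f :: "real \<times> real \<Rightarrow> complex"
  assumes "A * D - B * C = 1" and "B \<noteq> 0"
    and "square_integrable lborel \<psi>"
    and "admissible_with_constant (A, B, C, D, p, q) \<psi> C\<^sub>\<psi>" and "C\<^sub>\<psi> \<noteq> 0"
    and "square_integrable half_plane_measure f"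
  shows "(\<exists>g. square_integrable lborel g \<and>
            (AE (b, a) in half_plane_measure.
               f (b, a) = sa_wavelet_transform (A, B, C, D, p, q) \<psi> g b a)) \<longleftrightarrow>
         (AE (b', a') in half_plane_measure.
            f (b', a') = 1 / complex_of_real C\<^sub>\<psi> *
              (\<integral>(b, a). f (b, a) *
                 L2_inner lborel (sa_wavelet (A, B, C, D, p, q) \<psi> b a)
                                 (sa_wavelet (A, B, C, D, p, q) \<psi> b' a')
               \<partial>half_plane_measure))"
proof -
  note B = assms(2) and \<psi> = assms(3) and adm = assms(4) and f = assms(6)
  let ?M = "(A, B, C, D, p, q)"
  let ?W = "wavelet_image ?M \<psi>"
  let ?H = half_plane_measure
  have c: "C\<^sub>\<psi> > 0" using adm assms(5) by (simp add: admissible_with_constant_def)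
  note W_sq = wavelet_transform_isometry(1)[OF B \<psi> adm]
  have integral_eq: "(\<integral>(b, a). f (b, a) * L2_inner lborel (sa_wavelet ?M \<psi> b a) (sa_wavelet ?M \<psi> b' a') \<partial>?H)
      = L2_inner ?H f (?W (sa_wavelet ?M \<psi> b' a'))" for b' a'
    unfolding L2_inner_def[of ?H]
  proof (intro Bochner_Integration.integral_cong refl)
    fix x :: "real \<times> real"
    show "(case x of (b, a) \<Rightarrow> f (b, a) * L2_inner lborel (sa_wavelet ?M \<psi> b a) (sa_wavelet ?M \<psi> b' a'))
        = f x * cnj (?W (sa_wavelet ?M \<psi> b' a') x)"
      by (cases x) (simp add: wavelet_image_def sa_wavelet_transform_inner flip: L2_inner_commute)
  qed
  \<comment> \<open>the reproducing property of the kernel on the range of the transform\<close>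
  have reproduce: "L2_inner ?H (?W g) (?W (sa_wavelet ?M \<psi> b' a')) = C\<^sub>\<psi> * ?W g (b', a')"
    if g: "square_integrable lborel g" and a': "a' > 0" for g b' a'
    using wavelet_transform_inner[OF B \<psi> adm g square_integrable_sa_wavelet[OF \<psi> a']]
    by (simp add: wavelet_image_def sa_wavelet_transform_inner)
  show ?thesis
  proof
    assume "\<exists>g. square_integrable lborel g \<and> (AE (b, a) in ?H. f (b, a) = sa_wavelet_transform ?M \<psi> g b a)"
    then obtain g where g: "square_integrable lborel g" and fg: "AE x in ?H. f x = ?W g x"
      by (auto simp: wavelet_image_def case_prod_beta)
    have "L2_inner ?H f e = L2_inner ?H (?W g) e" if "square_integrable ?H e" for e
      by (rule L2_inner_cong_AE[OF fg f W_sq[OF g] that])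
    then have inner_eq: "L2_inner ?H f (?W (sa_wavelet ?M \<psi> b' a')) = C\<^sub>\<psi> * ?W g (b', a')" if "a' > 0" for b' a'
      using that by (simp add: reproduce g W_sq square_integrable_sa_wavelet \<psi>)
    show "AE (b', a') in ?H. f (b', a') = 1 / complex_of_real C\<^sub>\<psi> *
        (\<integral>(b, a). f (b, a) * L2_inner lborel (sa_wavelet ?M \<psi> b a) (sa_wavelet ?M \<psi> b' a') \<partial>?H)"
      unfolding integral_eq using fg AE_half_plane_pos
      by eventually_elim (use c inner_eq in \<open>auto split: prod.split\<close>)
  next
    assume kernel: "AE (b', a') in ?H. f (b', a') = 1 / complex_of_real C\<^sub>\<psi> *
        (\<integral>(b, a). f (b, a) * L2_inner lborel (sa_wavelet ?M \<psi> b a) (sa_wavelet ?M \<psi> b' a') \<partial>?H)"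
    \<comment> \<open>closed under almost everywhere equality, since the transform is additive at points with \<open>a > 0\<close>, outside which the measure vanishes\<close>
    define V where "V = {v. square_integrable ?H v \<and> (\<exists>g. square_integrable lborel g \<and> (AE x in ?H. v x = ?W g x))}"
    have V_I: "v \<in> V" if "square_integrable ?H v" "square_integrable lborel g" "AE x in ?H. v x = ?W g x" for v g
      using that by (auto simp: V_def)
    have V_range: "?W g \<in> V" if "square_integrable lborel g" for g
      using that W_sq by (auto simp: V_def)
    obtain v where vV: "v \<in> V" and orth: "\<And>e. e \<in> V \<Longrightarrow> L2_inner ?H (\<lambda>x. f x - v x) e = 0"
    proof (rule L2_projection[of V ?H f])
      show "square_integrable ?H v" if "v \<in> V" for v using that by (simp add: V_def)
      show "V \<noteq> {}" using V_range[OF \<psi>] by blast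
      show "square_integrable ?H f" by (rule f)
    next
      fix v w assume "v \<in> V" "w \<in> V"
      then obtain g k where v: "square_integrable ?H v" "square_integrable lborel g" "AE x in ?H. v x = ?W g x"
        and w: "square_integrable ?H w" "square_integrable lborel k" "AE x in ?H. w x = ?W k x"
        by (auto simp: V_def)
      have "AE x in ?H. v x + w x = ?W (\<lambda>t. g t + k t) x"
        using v(3) w(3) AE_half_plane_pos by eventually_elim (simp add: wavelet_image_add \<psi> v w)
      then show "(\<lambda>x. v x + w x) \<in> V"
        by (rule V_I[OF square_integrable_add[OF v(1) w(1)] square_integrable_add[OF v(2) w(2)]])
    next
      fix z v assume "v \<in> V"
      then obtain g where v: "square_integrable ?H v" "square_integrable lborel g" "AE x in ?H. v x = ?W g x"
        by (auto simp: V_def)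
      have "AE x in ?H. z * v x = ?W (\<lambda>t. z * g t) x"
        using v(3) by eventually_elim (simp add: wavelet_image_cmult)
      then show "(\<lambda>x. z * v x) \<in> V"
        by (rule V_I[OF square_integrable_cmult[OF v(1)] square_integrable_cmult[OF v(2)]])
    next
      fix u :: "nat \<Rightarrow> real \<times> real \<Rightarrow> complex"
      assume u: "\<And>n. u n \<in> V" and Cau: "L2_Cauchy ?H u"
      then have "\<forall>n. \<exists>g. square_integrable ?H (u n) \<and> square_integrable lborel g \<and> (AE x in ?H. u n x = ?W g x)"
        by (auto simp: V_def)
      then obtain k where u_sq: "\<And>n. square_integrable ?H (u n)" and k: "\<And>n. square_integrable lborel (k n)"
        and uk: "\<And>n. AE x in ?H. u n x = ?W (k n) x" by metis
      have "L2_sqnorm ?H (\<lambda>x. u i x - u j x) = L2_sqnorm ?H (\<lambda>x. ?W (k i) x - ?W (k j) x)" for i j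
      proof (rule L2_sqnorm_cong_AE)
        show "AE x in ?H. u i x - u j x = ?W (k i) x - ?W (k j) x"
          using uk[of i] uk[of j] by eventually_elim simp
      qed (intro square_integrable_measurable square_integrable_diff u_sq W_sq k)+
      then have "L2_Cauchy ?H (\<lambda>n. ?W (k n))" using Cau by (simp add: L2_Cauchy_def)
      from wavelet_range_complete[OF B \<psi> adm c k this]
      obtain r g where r: "strict_mono r" and g: "square_integrable lborel g"
        and lim: "L2_lim ?H (\<lambda>n. ?W (k (r n))) (?W g)" .
      have "L2_energy ?H (\<lambda>x. u (r n) x - ?W g x) = L2_energy ?H (\<lambda>x. ?W (k (r n)) x - ?W g x)" for n
        by (rule L2_energy_cong_AE, use uk[of "r n"] in eventually_elim) simp
      then have "L2_lim ?H (\<lambda>n. u (r n)) (?W g)" using lim by (simp add: L2_lim_energy)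
      then show "\<exists>r v. strict_mono r \<and> v \<in> V \<and> L2_lim ?H (\<lambda>n. u (r n)) v"
        using r V_range[OF g] by blast
    qed (rule that)
    then obtain g where v: "square_integrable ?H v" and g: "square_integrable lborel g" and vg: "AE x in ?H. v x = ?W g x"
      by (auto simp: V_def)
    have inner_eq: "L2_inner ?H f (?W (sa_wavelet ?M \<psi> b' a')) = C\<^sub>\<psi> * ?W g (b', a')" if a': "a' > 0" for b' a'
    proof -
      let ?e = "?W (sa_wavelet ?M \<psi> b' a')"
      have w: "square_integrable lborel (sa_wavelet ?M \<psi> b' a')" by (rule square_integrable_sa_wavelet[OF \<psi> a'])
      have "L2_inner ?H f ?e = L2_inner ?H v ?e"
        using orth[OF V_range[OF w]] by (simp add: L2_inner_diff_left f v W_sq w)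
      also have "\<dots> = L2_inner ?H (?W g) ?e"
        by (rule L2_inner_cong_AE[OF vg v W_sq[OF g] W_sq[OF w]])
      finally show ?thesis by (simp add: reproduce g a')
    qed
    have "AE x in ?H. f x = ?W g x"
      using kernel AE_half_plane_pos unfolding integral_eq
      by eventually_elim (use c inner_eq in \<open>auto split: prod.splits\<close>)
    then show "\<exists>g. square_integrable lborel g \<and> (AE (b, a) in ?H. f (b, a) = sa_wavelet_transform ?M \<psi> g b a)"
      using g by (auto simp: wavelet_image_def case_prod_beta)
  qed
qed

end
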